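(* Let $n\ge 5$ be odd and $m=\frac{2^n+1}{3}$. Let $\ell\ge 1$ be such that $\rho_{\ell+1}=(1,2,k)$, i.e. $\rho_{\ell+1}=7m+8k$, for some integer $0\le k<m$. Then $$d_{ORD}(C_\ell(P_\infty))=\begin{cases} 6, & \text{if } k=0,\\ 8, & \text{if } 1\le k\le\lfloor\frac{m}{4}\rfloor,\\ 8\left(\lceil k-\frac{m}{4}\rceil+1\right), & \text{if } \lceil\frac{m}{4}\rceil\le k\le\lfloor\frac{m}{2}\rfloor-2,\\ 2\left(\lceil k+\frac{m}{2}\rceil+1\right)+6\left(\lceil k+\frac{m}{2}\rceil-m+1\right), & \text{if } \lfloor\frac{m}{2}\rfloor-1\le k\le\lfloor\frac{3m}{4}\rfloor-2,\\ 4\left(\lceil k+\frac{m}{4}\rceil+1\right)+4\left(\lceil k+\frac{m}{4}\rceil-m+1\right), & \text{if } \lfloor\frac{3m}{4}\rfloor-1\le k\le m-2,\\ \nu_\ell=6m, & \text{if } k=m-1.\end{cases}$$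
   Context: Let $n\ge5$ be odd, $m=(2^n+1)/3$, and let $GGS(2,n)$ be (the nonsingular model of) the curve $X^2+X=Y^{3}$, $Y^{4}-Y=Z^m$; it is $\mathbb F_{2^{2n}}$-maximal of genus $g=\frac{9m-7}{2}$ and has a unique point at infinity $P_\infty$. The Weierstrass semigroup $H(P_\infty)$ (the set of $r\ge 0$ such that some rational function has pole divisor $rP_\infty$) is known to be $$H(P_\infty)=\{3im+2jm+8k \mid i\in\{0,1\},\ j\in\{0,1,2,3\},\ k\ge0\},$$ and each element has a unique such representation; $(i,j,k)$ denotes the element $3im+2jm+8k$. Write $H(P_\infty)=\{\rho_1=0<\rho_2<\rho_3<\cdots\}$. For $\ell\ge1$, $\nu_\ell$ is the number of ordered pairs $(a,b)\in H(P_\infty)\times H(P_\infty)$ with $a+b=\rho_{\ell+1}$. Let $\overline D$ be the sum of all $\mathbb F_{2^{2n}}$-rational points other than $P_\infty$, and $C_\ell(P_\infty)=C^\perp(\overline D,\rho_\ell P_\infty)$ the dual of the one-point AG code obtained by evaluating $\mathcal L(\rho_\ell P_\infty)$ at the points of $\overline D$. The order bound (Feng-Rao designed minimum distance) is $d_{ORD}(C_\ell(P_\infty))=\min\{\nu_r\mid r\ge\ell\}$. *)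

theory Defs
  imports Complex_Main "HOL-Computational_Algebra.Polynomial" "HOL-Library.Infinite_Set"
begin

definition is_subfield :: "'a::field set \<Rightarrow> bool" where
  "is_subfield K \<longleftrightarrow> 0 \<in> K \<and> 1 \<in> K \<and>
     (\<forall>a\<in>K. \<forall>b\<in>K. a + b \<in> K \<and> a - b \<in> K \<and> a * b \<in> K \<and> a / b \<in> K)"

definition transcendental_over :: "'a::field set \<Rightarrow> 'a \<Rightarrow> bool" where
  "transcendental_over K t \<longleftrightarrow>
     (\<forall>p. p \<noteq> 0 \<and> set (coeffs p) \<subseteq> K \<longrightarrow> poly p t \<noteq> 0)"

(* The ambient type is the function field of GGS(2,n) over K = GF(2^(2n)), with coordinate
   functions x, y, z. The affine curve is irreducible, so these conditions (z transcendental
   expresses transcendence degree 1) determine the field and x, y, z up to isomorphism over K. *)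
definition GGS2_function_field :: "nat \<Rightarrow> 'a::field set \<Rightarrow> 'a \<Rightarrow> 'a \<Rightarrow> 'a \<Rightarrow> bool" where
  "GGS2_function_field n K x y z \<longleftrightarrow>
     is_subfield K \<and> card K = 2 ^ (2 * n) \<and>
     x ^ 2 + x = y ^ 3 \<and> y ^ 4 - y = z ^ ((2 ^ n + 1) div 3) \<and>
     transcendental_over K z \<and>
     (\<forall>L. is_subfield L \<and> K \<union> {x, y, z} \<subseteq> L \<longrightarrow> L = UNIV)"

(* Points of the nonsingular model (closed points over K) are the places of the function field,
   represented by their normalized discrete valuations, trivial on K. The value at 0, which
   should be infinity, is the dummy 0, so that distinct valuations are distinct places. *)
definition place :: "'a::field set \<Rightarrow> ('a \<Rightarrow> int) \<Rightarrow> bool" where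
  "place K v \<longleftrightarrow> v 0 = 0 \<and>
     (\<forall>f g. f \<noteq> 0 \<longrightarrow> g \<noteq> 0 \<longrightarrow> v (f * g) = v f + v g) \<and>
     (\<forall>f g. f \<noteq> 0 \<longrightarrow> g \<noteq> 0 \<longrightarrow> f + g \<noteq> 0 \<longrightarrow> min (v f) (v g) \<le> v (f + g)) \<and>
     (\<forall>c\<in>K. c \<noteq> 0 \<longrightarrow> v c = 0) \<and>
     surj v"

(* A place not centred at a point of the affine curve: some coordinate function has a pole.
   For the GGS curve there is exactly one such place. *)
definition place_at_infinity :: "'a::field set \<Rightarrow> 'a \<Rightarrow> 'a \<Rightarrow> 'a \<Rightarrow> ('a \<Rightarrow> int) \<Rightarrow> bool" where
  "place_at_infinity K x y z v \<longleftrightarrow> place K v \<and> (v x < 0 \<or> v y < 0 \<or> v z < 0)"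

definition pole_order :: "('a::field \<Rightarrow> int) \<Rightarrow> 'a \<Rightarrow> nat" where
  "pole_order v f = nat (- v f)"

definition weierstrass_semigroup :: "'a::field set \<Rightarrow> ('a \<Rightarrow> int) \<Rightarrow> nat set" where
  "weierstrass_semigroup K P =
     {r. \<exists>f. f \<noteq> 0 \<and> pole_order P f = r \<and> (\<forall>Q. place K Q \<and> Q \<noteq> P \<longrightarrow> pole_order Q f = 0)}"

(* Indexed from 1: rho K P 1 = 0. *)
definition rho :: "'a::field set \<Rightarrow> ('a \<Rightarrow> int) \<Rightarrow> nat \<Rightarrow> nat" where
  "rho K P l = enumerate (weierstrass_semigroup K P) (l - 1)"

definition nu :: "'a::field set \<Rightarrow> ('a \<Rightarrow> int) \<Rightarrow> nat \<Rightarrow> nat" where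
  "nu K P l = card {(a, b). a \<in> weierstrass_semigroup K P \<and> b \<in> weierstrass_semigroup K P \<and>
                            a + b = rho K P (l + 1)}"

(* The order bound of the code C_l(P); it depends only on P and l, through the semigroup.
   Inf on nat is the least element of a nonempty set. *)
definition d_ORD :: "'a::field set \<Rightarrow> ('a \<Rightarrow> int) \<Rightarrow> nat \<Rightarrow> nat" where
  "d_ORD K P l = Inf {nu K P r | r. l \<le> r}"

end

theory Submission
  imports Defs
begin

text \<open>
  With \<open>w = y\<^sup>2 + y\<close> the curve is a tower of three Artin-Schreier extensions \<open>w\<^sup>2 + w = z\<^sup>m\<close>,
  \<open>y\<^sup>2 + y = w\<close>, \<open>x\<^sup>2 + x = y\<^sup>3\<close> of \<open>K(z)\<close>. At a place at infinity the coordinates \<open>z\<close>, \<open>w\<close>, \<open>y\<close>,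
  \<open>x\<close> have pole orders \<open>8\<close>, \<open>4m\<close>, \<open>2m\<close>, \<open>3m\<close> up to a common factor, so the eight monomials in
  \<open>w\<close>, \<open>y\<close>, \<open>x\<close> have pole orders distinct modulo 8. Hence the place is unique, the common factor is 1,
  and the pole orders of \<open>K[x, y, z]\<close> are exactly the numbers \<open>3im + 2jm + 8k\<close>.

  Every function regular outside infinity lies in \<open>R = K[x, y, z]\<close>: the tower is unramified over the
  affine line, which shows up as the fact that modulo a prime \<open>p\<close> of \<open>K[z]\<close> some iterate of the
  Frobenius map is the identity on \<open>R\<close>. Thus \<open>p\<close> generates the maximal ideal of each local ring above
  it, so each maximal ideal of \<open>R\<close> carries a place, and a function outside \<open>R\<close> has a pole at one.

  For the order bound, the number of decompositions of \<open>cm + 8k\<close> in the semigroup is a sum of eight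
  truncated linear functions of \<open>k\<close>, one for each class modulo 8. It increases with \<open>k\<close>, so the
  minimum is attained at the first element of one of the eight classes.
\<close>

section \<open>Subrings, ideals and polynomial rings\<close>

text \<open>Translation by 1 permutes \<open>K\<close>; comparing the sums over \<open>K\<close>
  shows that \<open>card K\<close> vanishes in the field, and so does its prime factor 2.\<close>

lemma two_eq_0_if_card_subfield:
  fixes K :: "'a::field set"
  assumes K: "is_subfield K" "card K = 2 ^ N"
  shows "(2::'a) = 0"
proof -
  have "bij_betw (\<lambda>a. a + 1) K K"
    using K(1) by (intro bij_betw_byWitness[where f' = "\<lambda>a. a - 1"]) (auto simp: is_subfield_def)
  then have "(\<Sum>a\<in>K. a + 1) = \<Sum>K"
    using sum.reindex_bij_betw[of "\<lambda>a. a + 1" K K "\<lambda>a. a"] by simp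
  then have "(of_nat (card K) :: 'a) = 0"
    by (simp add: sum.distrib)
  then show ?thesis
    using K(2) by simp
qed

text \<open>Multiplication by a nonzero \<open>c\<close> permutes the nonzero elements of
  \<open>K\<close>; comparing the two products gives Fermat's little theorem for
  \<open>K\<close>.\<close>

lemma power_card_subfield:
  assumes K: "is_subfield K" and "finite K" and c: "c \<in> K"
  shows "c ^ card K = c"
proof (cases "c = 0")
  case True
  then show ?thesis
    using assms by (auto simp: card_gt_0_iff power_0_left)
next
  case False
  have zK: "0 \<in> K"
    using K by (simp add: is_subfield_def)
  have "bij_betw (\<lambda>a. c * a) (K - {0}) (K - {0})"
    using K c False by (intro bij_betw_byWitness[where f' = "\<lambda>a. a / c"]) (auto simp: is_subfield_def)
  then have "(\<Prod>a\<in>K - {0}. c * a) = \<Prod>(K - {0})"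
    using prod.reindex_bij_betw[of "\<lambda>a. c * a" "K - {0}" "K - {0}" "\<lambda>a. a"] by simp
  then have "c ^ card (K - {0}) * \<Prod>(K - {0}) = \<Prod>(K - {0})"
    by (simp add: prod.distrib)
  moreover have "\<Prod>(K - {0}) \<noteq> 0"
    using \<open>finite K\<close> by simp
  ultimately have "c ^ card (K - {0}) = 1"
    by simp
  moreover have "card K = Suc (card (K - {0}))"
    using \<open>finite K\<close> zK by (metis card_Suc_Diff1)
  ultimately show ?thesis
    by simp
qed

section \<open>Arithmetic in characteristic 2\<close>

lemma char2_uminus:
  assumes "(2::'a::comm_ring_1) = 0"
  shows "- a = (a::'a)"
proof -
  have "a + a = 2 * a"
    by simp
  then have "a + a = 0"
    using assms by simp
  then show ?thesis
    by (rule minus_unique)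
qed

lemma char2_diff:
  assumes "(2::'a::comm_ring_1) = 0"
  shows "a - b = a + (b::'a)"
  by (metis assms char2_uminus diff_conv_add_uminus)

lemma char2_power_add:
  assumes "(2::'a::comm_ring_1) = 0"
  shows "(a + b) ^ (2 ^ N) = a ^ (2 ^ N) + (b::'a) ^ (2 ^ N)"
proof (induction N)
  case (Suc N)
  have "(a + b) ^ (2 ^ Suc N) = ((a + b) ^ (2 ^ N))\<^sup>2"
    by (metis power_Suc2 power_mult)
  also have "\<dots> = (a ^ (2 ^ N))\<^sup>2 + (b ^ (2 ^ N))\<^sup>2 + 2 * a ^ (2 ^ N) * b ^ (2 ^ N)"
    unfolding Suc.IH by (rule power2_sum)
  also have "\<dots> = (a ^ (2 ^ N))\<^sup>2 + (b ^ (2 ^ N))\<^sup>2"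
    using assms by simp
  finally show ?case
    by (metis power_Suc2 power_mult)
qed simp

section \<open>Subrings and ideals as subsets of one ambient ring\<close>

definition is_subring :: "'a::comm_ring_1 set \<Rightarrow> bool" where
  "is_subring A \<longleftrightarrow> 0 \<in> A \<and> 1 \<in> A \<and> (\<forall>a\<in>A. \<forall>b\<in>A. a + b \<in> A \<and> a - b \<in> A \<and> a * b \<in> A)"

definition is_ideal :: "'a::comm_ring_1 set \<Rightarrow> 'a set \<Rightarrow> bool" where
  "is_ideal R I \<longleftrightarrow> I \<subseteq> R \<and> 0 \<in> I \<and> (\<forall>a\<in>I. \<forall>b\<in>I. a + b \<in> I) \<and> (\<forall>r\<in>R. \<forall>a\<in>I. r * a \<in> I)"

definition is_prime_ideal :: "'a::comm_ring_1 set \<Rightarrow> 'a set \<Rightarrow> bool" where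
  "is_prime_ideal R M \<longleftrightarrow>
     is_ideal R M \<and> 1 \<notin> M \<and> (\<forall>a\<in>R. \<forall>b\<in>R. a * b \<in> M \<longrightarrow> a \<in> M \<or> b \<in> M)"

text \<open>Linear expressions in \<open>t\<close> suffice because \<open>t\<close> will always
  satisfy a monic quadratic equation over \<open>A\<close>.\<close>

definition adjoin :: "'a::comm_ring_1 set \<Rightarrow> 'a \<Rightarrow> 'a set" where
  "adjoin A t = {a + b * t | a b. a \<in> A \<and> b \<in> A}"

definition poly_ring :: "'a::field set \<Rightarrow> 'a \<Rightarrow> 'a set" where
  "poly_ring K z = {poly q z | q. set (coeffs q) \<subseteq> K}"

definition fraction_field :: "'a::field set \<Rightarrow> 'a set" where
  "fraction_field R = {a / b | a b. a \<in> R \<and> b \<in> R \<and> b \<noteq> 0}"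

lemma is_subringD:
  assumes "is_subring A"
  shows "0 \<in> A" "1 \<in> A" "a \<in> A \<Longrightarrow> b \<in> A \<Longrightarrow> a + b \<in> A" "a \<in> A \<Longrightarrow> b \<in> A \<Longrightarrow> a - b \<in> A"
    "a \<in> A \<Longrightarrow> b \<in> A \<Longrightarrow> a * b \<in> A"
  using assms by (auto simp: is_subring_def)

lemma is_subring_uminus: "is_subring A \<Longrightarrow> a \<in> A \<Longrightarrow> - a \<in> A"
  using is_subringD(1,4)[of A] by fastforce

lemma is_subring_power: "is_subring A \<Longrightarrow> a \<in> A \<Longrightarrow> a ^ N \<in> A"
  by (induction N) (auto simp: is_subring_def)

lemma is_idealD:
  assumes "is_ideal R I"
  shows "a \<in> I \<Longrightarrow> a \<in> R" "0 \<in> I" "a \<in> I \<Longrightarrow> b \<in> I \<Longrightarrow> a + b \<in> I" "r \<in> R \<Longrightarrow> a \<in> I \<Longrightarrow> r * a \<in> I"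
  using assms by (auto simp: is_ideal_def)

lemma is_ideal_uminus: "is_subring R \<Longrightarrow> is_ideal R I \<Longrightarrow> a \<in> I \<Longrightarrow> - a \<in> I"
  using is_idealD(4)[of R I "- 1" a] is_subring_uminus[of R 1] is_subringD(2)[of R] by simp

lemma is_ideal_diff: "is_subring R \<Longrightarrow> is_ideal R I \<Longrightarrow> a \<in> I \<Longrightarrow> b \<in> I \<Longrightarrow> a - b \<in> I"
  using is_idealD(3)[of R I a "- b"] is_ideal_uminus[of R I b] by simp

lemma is_prime_idealD:
  assumes "is_prime_ideal R M"
  shows "is_ideal R M" "1 \<notin> M" "a \<in> R \<Longrightarrow> b \<in> R \<Longrightarrow> a * b \<in> M \<Longrightarrow> a \<in> M \<or> b \<in> M"
  using assms by (auto simp: is_prime_ideal_def)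

lemma is_prime_ideal_power:
  assumes "is_subring R" "is_prime_ideal R M" "a \<in> R" "a ^ N \<in> M"
  shows "a \<in> M"
  using assms(4)
proof (induction N)
  case 0
  then show ?case
    using is_prime_idealD(2)[OF assms(2)] by simp
next
  case (Suc N)
  then show ?case
    using is_prime_idealD(3)[OF assms(2) assms(3) is_subring_power[OF assms(1,3)], of N] by auto
qed

lemma is_ideal_principal:
  assumes "is_subring R" "p \<in> R"
  shows "is_ideal R ((*) p ` R)"
  unfolding is_ideal_def
proof (intro conjI ballI)
  show "(*) p ` R \<subseteq> R"
    using assms is_subringD(5) by blast
  show "0 \<in> (*) p ` R"
    using is_subringD(1)[OF assms(1)] by force
next
  fix a b assume "a \<in> (*) p ` R" "b \<in> (*) p ` R"
  then obtain r s where "r \<in> R" "s \<in> R" "a = p * r" "b = p * s"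
    by blast
  then have "a + b = p * (r + s)" "r + s \<in> R"
    using is_subringD(3)[OF assms(1)] by (auto simp: algebra_simps)
  then show "a + b \<in> (*) p ` R"
    by blast
next
  fix r a assume "r \<in> R" "a \<in> (*) p ` R"
  then obtain s where "s \<in> R" "a = p * s"
    by blast
  then have "r * a = p * (r * s)" "r * s \<in> R"
    using is_subringD(5)[OF assms(1)] \<open>r \<in> R\<close> by (auto simp: algebra_simps)
  then show "r * a \<in> (*) p ` R"
    by blast
qed

text \<open>By Zorn's lemma there is a maximal element among the proper ideals above
  \<open>I\<close>, and such an ideal is prime.\<close>

lemma exists_prime_ideal_superset:
  assumes R: "is_subring R" and I: "is_ideal R I" "1 \<notin> I"
  obtains M where "is_prime_ideal R M" "I \<subseteq> M"
proof -
  define Z where "Z = {J. is_ideal R J \<and> 1 \<notin> J \<and> I \<subseteq> J}"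
  have "\<exists>M\<in>Z. \<forall>X\<in>Z. M \<subseteq> X \<longrightarrow> X = M"
  proof (rule subset_Zorn_nonempty)
    show "Z \<noteq> {}"
      using I by (auto simp: Z_def)
  next
    fix C assume C: "C \<noteq> {}" "subset.chain Z C"
    then have *: "\<And>J. J \<in> C \<Longrightarrow> is_ideal R J \<and> 1 \<notin> J \<and> I \<subseteq> J"
      by (auto simp: subset.chain_def Z_def)
    have tot: "\<And>J L. J \<in> C \<Longrightarrow> L \<in> C \<Longrightarrow> J \<subseteq> L \<or> L \<subseteq> J"
      using C by (auto simp: subset.chain_def)
    have "is_ideal R (\<Union>C)"
      unfolding is_ideal_def
    proof (intro conjI ballI)
      fix a b assume "a \<in> \<Union>C" "b \<in> \<Union>C"
      then obtain J L where "J \<in> C" "L \<in> C" "a \<in> J" "b \<in> L"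
        by blast
      with tot have "\<exists>J\<in>C. a \<in> J \<and> b \<in> J"
        by blast
      then show "a + b \<in> \<Union>C"
        using * is_idealD(3) by blast
    next
      show "\<Union>C \<subseteq> R"
        using * is_idealD(1) by blast
      obtain J where "J \<in> C"
        using C by blast
      then show "0 \<in> \<Union>C"
        using * is_idealD(2) by blast
    next
      fix r a assume "r \<in> R" "a \<in> \<Union>C"
      then show "r * a \<in> \<Union>C"
        using * is_idealD(4) by blast
    qed
    then show "\<Union>C \<in> Z"
      using * C by (auto simp: Z_def)
  qed
  then obtain M where M: "is_ideal R M" "1 \<notin> M" "I \<subseteq> M"
    and max: "\<And>X. is_ideal R X \<Longrightarrow> 1 \<notin> X \<Longrightarrow> M \<subseteq> X \<Longrightarrow> X = M"
    by (auto simp: Z_def)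
  have "a \<in> M \<or> b \<in> M" if ab: "a \<in> R" "b \<in> R" "a * b \<in> M" for a b
  proof (rule ccontr)
    assume contra: "\<not> (a \<in> M \<or> b \<in> M)"
    \<comment> \<open>This is the ideal \<open>M + aR\<close>. It is strictly larger than
      \<open>M\<close>, hence contains 1 by maximality; multiplying \<open>1 = u + a * r\<close> by
      \<open>b\<close> then puts \<open>b\<close> into \<open>M\<close>.\<close>
    define X where "X = {u + a * r | u r. u \<in> M \<and> r \<in> R}"
    have XM: "u + a * r \<in> X" if "u \<in> M" "r \<in> R" for u r
      using that by (auto simp: X_def)
    have "is_ideal R X"
      unfolding is_ideal_def
    proof (intro conjI ballI)
      show "X \<subseteq> R"
        using ab(1) is_idealD(1)[OF M(1)] is_subringD(3,5)[OF R] by (auto simp: X_def)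
      show "0 \<in> X"
        using XM[OF is_idealD(2)[OF M(1)] is_subringD(1)[OF R]] by simp
    next
      fix c d assume "c \<in> X" "d \<in> X"
      then obtain u r u' r' where "u \<in> M" "u' \<in> M" "r \<in> R" "r' \<in> R" "c = u + a * r" "d = u' + a * r'"
        by (auto simp: X_def)
      then show "c + d \<in> X"
        using XM[OF is_idealD(3)[OF M(1), of u u'] is_subringD(3)[OF R, of r r']]
        by (simp add: algebra_simps)
    next
      fix s c assume "s \<in> R" "c \<in> X"
      then obtain u r where "u \<in> M" "r \<in> R" "c = u + a * r"
        by (auto simp: X_def)
      then show "s * c \<in> X"
        using XM[OF is_idealD(4)[OF M(1), of s u] is_subringD(5)[OF R, of s r]] \<open>s \<in> R\<close>
        by (simp add: algebra_simps)
    qed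
    moreover have "M \<subseteq> X"
      using XM[OF _ is_subringD(1)[OF R]] by fastforce
    moreover have "a \<in> X"
      using XM[OF is_idealD(2)[OF M(1)] is_subringD(2)[OF R]] by simp
    ultimately have "1 \<in> X"
      using max contra by blast
    then obtain u r where "u \<in> M" "r \<in> R" "1 = u + a * r"
      by (auto simp: X_def)
    then have "b = b * u + r * (a * b)"
      by (metis mult.commute mult.left_commute mult_1 distrib_left)
    moreover have "b * u + r * (a * b) \<in> M"
      using is_idealD(3,4)[OF M(1)] ab \<open>u \<in> M\<close> \<open>r \<in> R\<close> by blast
    ultimately show False
      using contra by simp
  qed
  then have "is_prime_ideal R M"
    using M by (simp add: is_prime_ideal_def)
  then show ?thesis
    using M(3) that by blast
qed

lemma subset_adjoin: "is_subring A \<Longrightarrow> A \<subseteq> adjoin A t"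
  using is_subringD(1)[of A] unfolding adjoin_def by (force intro: exI[of _ 0])

lemma generator_in_adjoin: "is_subring A \<Longrightarrow> t \<in> adjoin A t"
  using is_subringD(1,2)[of A] unfolding adjoin_def
  by (intro CollectI exI[of _ 0] exI[of _ 1]) simp

lemma adjoin_subset: "is_subring R \<Longrightarrow> A \<subseteq> R \<Longrightarrow> t \<in> R \<Longrightarrow> adjoin A t \<subseteq> R"
  using is_subringD(3,5)[of R] unfolding adjoin_def by blast

lemma is_subring_adjoin:
  assumes A: "is_subring A" and t: "t\<^sup>2 + t \<in> A"
  shows "is_subring (adjoin A t)"
  unfolding is_subring_def
proof (intro conjI ballI)
  show "0 \<in> adjoin A t" "1 \<in> adjoin A t"
    using subset_adjoin[OF A] is_subringD(1,2)[OF A] by auto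
  fix f g assume "f \<in> adjoin A t" "g \<in> adjoin A t"
  then obtain a b c d where *: "a \<in> A" "b \<in> A" "c \<in> A" "d \<in> A" "f = a + b * t" "g = c + d * t"
    by (auto simp: adjoin_def)
  have I: "a + b * t \<in> adjoin A t" if "a \<in> A" "b \<in> A" for a b
    using that by (auto simp: adjoin_def)
  have "f + g = (a + c) + (b + d) * t"
    using * by (simp add: algebra_simps)
  then show "f + g \<in> adjoin A t"
    using * is_subringD(3)[OF A] by (simp only: I)
  have "f - g = (a - c) + (b - d) * t"
    using * by (simp add: algebra_simps)
  then show "f - g \<in> adjoin A t"
    using * is_subringD(4)[OF A] by (simp only: I)
  \<comment> \<open>The square of \<open>t\<close> is replaced by \<open>(t^2 + t) - t\<close>,
    where the bracket lies in \<open>A\<close>.\<close>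
  have "f * g = (a * c + b * d * (t\<^sup>2 + t)) + (a * d + b * c - b * d) * t"
    using * by (simp add: algebra_simps power2_eq_square)
  then show "f * g \<in> adjoin A t"
    using * t is_subringD(3,4,5)[OF A] by (simp only: I)
qed

section \<open>Polynomials with coefficients in a subset\<close>

lemma coeffs_subset_iff:
  assumes "0 \<in> K"
  shows "set (coeffs q) \<subseteq> K \<longleftrightarrow> (\<forall>i. coeff q i \<in> K)"
proof -
  have "set (coeffs q) \<subseteq> K \<longleftrightarrow> range (coeff q) \<subseteq> K"
    using assms by (simp add: range_coeff)
  then show ?thesis
    by blast
qed

lemma coeffs_subset_mult:
  assumes K: "is_subring K" and q: "set (coeffs q) \<subseteq> K" "set (coeffs r) \<subseteq> K"
  shows "set (coeffs (q * r)) \<subseteq> K"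
proof -
  have sumK: "sum g A \<in> K" if "\<And>i. g i \<in> K" for g :: "nat \<Rightarrow> 'a" and A
    using that by (induction A rule: infinite_finite_induct) (auto simp: is_subringD(1,3)[OF K])
  show ?thesis
    using q unfolding coeffs_subset_iff[OF is_subringD(1)[OF K]]
    by (auto simp: coeff_mult intro!: sumK is_subringD(5)[OF K])
qed

lemma coeffs_subset_add:
  assumes K: "is_subring K" and q: "set (coeffs q) \<subseteq> K" "set (coeffs r) \<subseteq> K"
  shows "set (coeffs (q + r)) \<subseteq> K" "set (coeffs (q - r)) \<subseteq> K"
  using q is_subringD(3,4)[OF K] unfolding coeffs_subset_iff[OF is_subringD(1)[OF K]] by auto

lemma is_subring_subfield: "is_subfield K \<Longrightarrow> is_subring K"
  by (auto simp: is_subfield_def is_subring_def)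

lemma is_subring_poly_ring:
  assumes K: "is_subring K"
  shows "is_subring (poly_ring K z)"
  unfolding is_subring_def
proof (intro conjI ballI)
  have I: "poly q z \<in> poly_ring K z" if "set (coeffs q) \<subseteq> K" for q
    using that by (auto simp: poly_ring_def)
  show "0 \<in> poly_ring K z" "1 \<in> poly_ring K z"
    using I[of 0] I[of 1] is_subringD(2)[OF K] by simp_all
  fix a b assume "a \<in> poly_ring K z" "b \<in> poly_ring K z"
  then obtain q r where q: "set (coeffs q) \<subseteq> K" "set (coeffs r) \<subseteq> K" "a = poly q z" "b = poly r z"
    by (auto simp: poly_ring_def)
  show "a + b \<in> poly_ring K z" "a - b \<in> poly_ring K z" "a * b \<in> poly_ring K z"
    using I[OF coeffs_subset_add(1)[OF K q(1,2)]] I[OF coeffs_subset_add(2)[OF K q(1,2)]]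
      I[OF coeffs_subset_mult[OF K q(1,2)]] q(3,4) by simp_all
qed

lemma subset_poly_ring: "K \<subseteq> poly_ring K z"
proof
  fix c assume "c \<in> K"
  then have "set (coeffs [:c:]) \<subseteq> K" "c = poly [:c:] z"
    by (auto simp: cCons_def)
  then show "c \<in> poly_ring K z"
    unfolding poly_ring_def by blast
qed

lemma generator_in_poly_ring:
  assumes "is_subring K"
  shows "z \<in> poly_ring K z"
proof -
  have "set (coeffs [:0, 1:]) \<subseteq> K" "z = poly [:0, 1:] z"
    using is_subringD(1,2)[OF assms] by (auto simp: cCons_def)
  then show "z \<in> poly_ring K z"
    unfolding poly_ring_def by blast
qed

lemma poly_ring_subset:
  assumes R: "is_subring R" and "K \<subseteq> R" "z \<in> R"
  shows "poly_ring K z \<subseteq> R"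
proof -
  have "poly q z \<in> R" if "set (coeffs q) \<subseteq> R" for q
    using that
  proof (induction q)
    case (pCons c q)
    then have "c \<in> R" "poly q z \<in> R"
      using is_subringD(1)[OF R] by (auto simp: cCons_def split: if_splits)
    then show ?case
      using is_subringD(3,5)[OF R] \<open>z \<in> R\<close> by simp
  qed (use is_subringD(1)[OF R] in simp)
  then show ?thesis
    using \<open>K \<subseteq> R\<close> by (auto simp: poly_ring_def)
qed

text \<open>Long division divides only by the leading coefficient of \<open>p\<close>, so quotient
  and remainder keep their coefficients in the subfield.\<close>

lemma coeffs_subset_division:
  assumes K: "is_subfield K" and p: "set (coeffs p) \<subseteq> K" "p \<noteq> 0" and q: "set (coeffs q) \<subseteq> K"
  shows "\<exists>s r. set (coeffs s) \<subseteq> K \<and> set (coeffs r) \<subseteq> K \<and> q = p * s + r \<and> (r = 0 \<or> degree r < degree p)"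
  using q
proof (induction "degree q" arbitrary: q rule: less_induct)
  case less
  note Kr = is_subring_subfield[OF K]
  have zK: "0 \<in> K"
    using K by (simp add: is_subfield_def)
  show ?case
  proof (cases "q = 0 \<or> degree q < degree p")
    case True
    then show ?thesis
      using less.prems by (intro exI[of _ 0] exI[of _ q]) auto
  next
    case False
    \<comment> \<open>The product \<open>p * h\<close> has the leading term of \<open>q\<close>, so
      \<open>q'\<close> below is zero or has smaller degree.\<close>
    define h where "h = monom (lead_coeff q / lead_coeff p) (degree q - degree p)"
    have "lead_coeff q \<in> K" "lead_coeff p \<in> K"
      using p(1) less.prems by (auto simp: coeffs_subset_iff[OF zK])
    then have "lead_coeff q / lead_coeff p \<in> K"
      using K by (simp add: is_subfield_def)
    then have hK: "set (coeffs h) \<subseteq> K"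
      using zK by (simp add: coeffs_subset_iff[OF zK] h_def)
    define q' where "q' = q - p * h"
    have q'K: "set (coeffs q') \<subseteq> K"
      unfolding q'_def by (intro coeffs_subset_add coeffs_subset_mult Kr less.prems p hK)
    have "lead_coeff q / lead_coeff p \<noteq> 0"
      using False p(2) by simp
    then have dh: "degree (p * h) = degree q" "h \<noteq> 0"
      using False p(2) by (auto simp: h_def degree_mult_eq degree_monom_eq monom_eq_0_iff)
    have lh: "coeff (p * h) (degree q) = coeff q (degree q)"
      using p(2) dh lead_coeff_mult[of p h] \<open>lead_coeff q / lead_coeff p \<noteq> 0\<close>
      by (simp add: h_def degree_monom_eq)
    have "\<exists>s r. set (coeffs s) \<subseteq> K \<and> set (coeffs r) \<subseteq> K \<and> q' = p * s + r \<and> (r = 0 \<or> degree r < degree p)"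
    proof (cases "q' = 0 \<or> degree q' < degree p")
      case True
      then show ?thesis
        using q'K by (intro exI[of _ 0] exI[of _ q']) auto
    next
      case F: False
      have "degree q' \<le> degree q"
        unfolding q'_def by (rule degree_diff_le) (use dh in auto)
      moreover have "degree q' \<noteq> degree q"
        using lh F by (metis (no_types, lifting) coeff_diff diff_self leading_coeff_0_iff q'_def)
      ultimately show ?thesis
        using less.hyps q'K by auto
    qed
    then obtain s r where "set (coeffs s) \<subseteq> K" "set (coeffs r) \<subseteq> K" "q' = p * s + r"
      "r = 0 \<or> degree r < degree p"
      by blast
    then have "q = p * (s + h) + r" "set (coeffs (s + h)) \<subseteq> K" "set (coeffs r) \<subseteq> K"
      "r = 0 \<or> degree r < degree p"
      using coeffs_subset_add(1)[OF Kr \<open>set (coeffs s) \<subseteq> K\<close> hK] by (auto simp: q'_def algebra_simps)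
    then show ?thesis
      by blast
  qed
qed

section \<open>Artin-Schreier steps and the Frobenius map\<close>

text \<open>The multiplier is the conjugate of \<open>f = a + b * t\<close> under
  \<open>t \<mapsto> t + 1\<close>, which preserves \<open>t^2 + t\<close> in characteristic 2; the
  product is the norm and lies in \<open>A\<close>.\<close>

lemma adjoin_dvd_base:
  fixes t :: "'a::field"
  assumes two: "(2::'a) = 0" and A: "is_subring A" and t: "t\<^sup>2 + t \<in> A"
    and f: "f \<in> adjoin A t" "f \<noteq> 0"
  shows "\<exists>g\<in>adjoin A t. f * g \<in> A \<and> f * g \<noteq> 0"
proof -
  obtain a b where ab: "a \<in> A" "b \<in> A" "f = a + b * t"
    using f(1) by (auto simp: adjoin_def)
  show ?thesis
  proof (cases "a + b + b * t = 0")
    \<comment> \<open>A vanishing conjugate cannot serve as multiplier, but then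
      \<open>f = b\<close> already lies in \<open>A\<close>.\<close>
    case True
    then have "f + b = 0"
      by (simp add: ab(3) algebra_simps)
    then have "f = b"
      using char2_uminus[OF two, of b] by (simp add: eq_neg_iff_add_eq_0[symmetric])
    then show ?thesis
      using ab(2) f(2) is_subringD(2)[OF A] subset_adjoin[OF A] by (intro bexI[of _ 1]) auto
  next
    case False
    have "f * (a + b + b * t) = a * a + a * b + b * b * (t\<^sup>2 + t) + 2 * (a * b * t)"
      by (simp add: ab(3) algebra_simps power2_eq_square)
    also have "\<dots> \<in> A"
      using ab(1,2) t is_subringD(3,5)[OF A] two by simp
    finally have "f * (a + b + b * t) \<in> A" .
    moreover have "a + b + b * t \<in> adjoin A t"
      using ab(1,2) is_subringD(3)[OF A] unfolding adjoin_def by blast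
    ultimately show ?thesis
      using False f(2) by (intro bexI[of _ "a + b + b * t"]) auto
  qed
qed

text \<open>An iterate of the Frobenius map is a ring homomorphism, so its congruence to the
  identity modulo \<open>I\<close> has to be checked only on generators.\<close>

lemma is_subring_frobenius_fixed:
  fixes R :: "'a::comm_ring_1 set"
  assumes two: "(2::'a) = 0" and R: "is_subring R" and I: "is_ideal R I"
  shows "is_subring {a \<in> R. a ^ (2 ^ N) - a \<in> I}"
proof -
  define Q :: nat where "Q = 2 ^ N"
  have Q: "(a + b) ^ Q = a ^ Q + b ^ Q" for a b :: 'a
    unfolding Q_def by (rule char2_power_add[OF two])
  have "Q > 0"
    by (simp add: Q_def)
  show ?thesis
    unfolding is_subring_def Q_def[symmetric]
  proof (intro conjI ballI)
    show "0 \<in> {a \<in> R. a ^ Q - a \<in> I}" "1 \<in> {a \<in> R. a ^ Q - a \<in> I}"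
      using \<open>Q > 0\<close> is_subringD(1,2)[OF R] is_idealD(2)[OF I] by (auto simp: power_0_left)
    fix a b assume "a \<in> {a \<in> R. a ^ Q - a \<in> I}" "b \<in> {a \<in> R. a ^ Q - a \<in> I}"
    then have ab: "a \<in> R" "b \<in> R" "a ^ Q - a \<in> I" "b ^ Q - b \<in> I"
      by auto
    have "(a + b) ^ Q - (a + b) = (a ^ Q - a) + (b ^ Q - b)"
      by (simp add: Q)
    then have "(a + b) ^ Q - (a + b) \<in> I"
      using is_idealD(3)[OF I ab(3,4)] by metis
    then show "a + b \<in> {a \<in> R. a ^ Q - a \<in> I}"
      using is_subringD(3)[OF R ab(1,2)] by blast
    then show "a - b \<in> {a \<in> R. a ^ Q - a \<in> I}"
      by (simp add: char2_diff[OF two])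
    have "(a * b) ^ Q - a * b = a ^ Q * (b ^ Q - b) + b * (a ^ Q - a)"
      by (simp add: power_mult_distrib algebra_simps)
    moreover have "a ^ Q * (b ^ Q - b) + b * (a ^ Q - a) \<in> I"
      using ab is_subring_power[OF R] by (intro is_idealD(3,4)[OF I]) auto
    ultimately show "a * b \<in> {a \<in> R. a ^ Q - a \<in> I}"
      using ab is_subringD(5)[OF R] by simp
  qed
qed

lemma ideal_power:
  assumes "is_subring R" "is_ideal R I" "a \<in> I" "N > 0"
  shows "a ^ N \<in> I"
proof -
  obtain N' where "N = Suc N'"
    using assms(4) gr0_implies_Suc by blast
  then have "a ^ N = a ^ N' * a"
    by (simp add: mult.commute)
  then show ?thesis
    using is_idealD(4)[OF assms(2) is_subring_power[OF assms(1) is_idealD(1)[OF assms(2,3)]] assms(3)]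
    by simp
qed

text \<open>The Frobenius map sends \<open>I\<close> into itself, so the congruence can be iterated.
  This brings different exponents to a common multiple.\<close>

lemma frobenius_fixed_iterate:
  fixes R :: "'a::comm_ring_1 set"
  assumes two: "(2::'a) = 0" and R: "is_subring R" and I: "is_ideal R I"
    and a: "a ^ (2 ^ N) - a \<in> I"
  shows "a ^ (2 ^ (N * k)) - a \<in> I"
proof (induction k)
  case 0
  then show ?case
    using is_idealD(2)[OF I] by simp
next
  case (Suc k)
  define c where "c = a ^ (2 ^ (N * k))"
  have "a ^ (2 ^ (N * Suc k)) = c ^ (2 ^ N)"
    by (simp add: c_def power_mult[symmetric] power_add[symmetric] add.commute)
  moreover have "(c - a) ^ (2 ^ N) = c ^ (2 ^ N) - a ^ (2 ^ N)"
    by (simp add: char2_diff[OF two] char2_power_add[OF two])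
  ultimately have "a ^ (2 ^ (N * Suc k)) - a = (c - a) ^ (2 ^ N) + (a ^ (2 ^ N) - a)"
    by simp
  moreover have "(c - a) ^ (2 ^ N) \<in> I"
    using Suc.IH by (intro ideal_power[OF R I]) (auto simp: c_def)
  ultimately show ?case
    using a is_idealD(3)[OF I] by metis
qed

text \<open>With \<open>s = t\<^sup>Q + t\<close>, where \<open>Q = 2 ^ N\<close>, one has \<open>s\<^sup>2 + s = u\<^sup>Q + u\<close> for
  \<open>u = t\<^sup>2 + t\<close>, so \<open>s\<close> is fixed by squaring modulo the ideal, and
  \<open>s\<^sup>Q + s\<close> equals \<open>t\<close> plus its image under the \<open>2 * N\<close>-th iterate of squaring.\<close>

lemma frobenius_fixed_artin_schreier:
  fixes R :: "'a::comm_ring_1 set"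
  assumes two: "(2::'a) = 0" and R: "is_subring R" and I: "is_ideal R I"
    and u: "(t\<^sup>2 + t) ^ (2 ^ N) - (t\<^sup>2 + t) \<in> I"
  shows "t ^ (2 ^ (N * 2)) - t \<in> I"
proof -
  define Q :: nat where "Q = 2 ^ N"
  have Q: "(a + b) ^ Q = a ^ Q + b ^ Q" for a b :: 'a
    unfolding Q_def by (rule char2_power_add[OF two])
  have sq: "(a + b)\<^sup>2 = a\<^sup>2 + b\<^sup>2" for a b :: 'a
    using char2_power_add[OF two, of a b 1] by simp
  define s where "s = t ^ Q + t"
  have "(t ^ Q)\<^sup>2 = (t\<^sup>2) ^ Q"
    by (simp add: power_mult[symmetric] mult.commute)
  then have "s ^ (2 ^ 1) - s = (t\<^sup>2 + t) ^ Q - (t\<^sup>2 + t)"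
    by (simp add: s_def sq Q char2_diff[OF two])
  then have "s ^ (2 ^ 1) - s \<in> I"
    using u by (simp add: Q_def)
  then have "s ^ Q - s \<in> I"
    using frobenius_fixed_iterate[OF two R I, of s 1 N] by (simp add: Q_def)
  moreover have "s ^ Q - s = t ^ (Q * Q) + (t ^ Q - t ^ Q) - t"
    unfolding s_def Q by (simp add: power_mult[symmetric])
  ultimately show ?thesis
    by (simp add: Q_def mult_2_right power_add)
qed

text \<open>Each Artin-Schreier step of the tower costs a factor 2 in the exponent. Since the fixed
  elements form a subring, it is enough to treat \<open>A\<close> and \<open>t\<close>.\<close>

lemma frobenius_fixed_adjoin:
  fixes R :: "'a::comm_ring_1 set"
  assumes two: "(2::'a) = 0" and R: "is_subring R" and I: "is_ideal R I"
    and A: "A \<subseteq> R" "\<forall>a\<in>A. a ^ (2 ^ N) - a \<in> I" and t: "t \<in> R" "t\<^sup>2 + t \<in> A"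
  shows "\<forall>a\<in>adjoin A t. a ^ (2 ^ (N * 2)) - a \<in> I"
proof -
  have "A \<subseteq> {a \<in> R. a ^ (2 ^ (N * 2)) - a \<in> I}"
    using A frobenius_fixed_iterate[OF two R I] by auto
  moreover have "t \<in> {a \<in> R. a ^ (2 ^ (N * 2)) - a \<in> I}"
    using A(2) t frobenius_fixed_artin_schreier[OF two R I] by auto
  ultimately show ?thesis
    using adjoin_subset[OF is_subring_frobenius_fixed[OF two R I]] by blast
qed

section \<open>Nonzero primes of \<open>K[z]\<close> and their finite residue rings\<close>

lemma finite_coeffs_subset_degree:
  assumes "finite K"
  shows "finite {q :: 'a::zero poly. set (coeffs q) \<subseteq> K \<and> (q = 0 \<or> degree q < d)}"
proof (rule finite_imageD)
  show "inj_on coeffs {q. set (coeffs q) \<subseteq> K \<and> (q = 0 \<or> degree q < d)}"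
    by (rule inj_onI) (simp only: coeffs_eq_iff)
  have len: "length (coeffs q) \<le> d" if "q = 0 \<or> degree q < d" for q :: "'a poly"
    using that by (cases "q = 0") (auto simp: length_coeffs_degree)
  have "coeffs ` {q. set (coeffs q) \<subseteq> K \<and> (q = 0 \<or> degree q < d)} \<subseteq> {xs. set xs \<subseteq> K \<and> length xs \<le> d}"
    using len by auto
  then show "finite (coeffs ` {q. set (coeffs q) \<subseteq> K \<and> (q = 0 \<or> degree q < d)})"
    using finite_lists_length_le[OF assms] finite_subset by blast
qed

text \<open>The ideal \<open>M\<close> meets \<open>K[z]\<close> in a nonzero prime, generated by a
  polynomial \<open>p\<close> of least degree. Its residue ring is finite, so some iterate of the
  Frobenius map is the identity on it.\<close>

lemma poly_ring_prime_generator: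
  fixes K :: "'a::field set"
  assumes two: "(2::'a) = 0" and K: "is_subfield K" "card K = 2 ^ h" "h > 0"
    and R: "is_subring R" "poly_ring K z \<subseteq> R" and z: "transcendental_over K z"
    and M: "is_prime_ideal R M" and a0: "a0 \<in> poly_ring K z" "a0 \<in> M" "a0 \<noteq> 0"
  obtains p N where "p \<in> poly_ring K z" "p \<in> M" "p \<noteq> 0" "N > 0"
    "\<forall>a\<in>poly_ring K z. a \<noteq> 0 \<longrightarrow> (\<exists>e. \<exists>c\<in>poly_ring K z - M. a = p ^ e * c)"
    "\<forall>a\<in>poly_ring K z. a ^ (2 ^ N) - a \<in> (*) p ` R"
proof -
  have Kr: "is_subring K"
    by (rule is_subring_subfield[OF K(1)])
  have finK: "finite K"
    using K(2) by (intro card_ge_0_finite) simp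
  define A where "A = poly_ring K z"
  have AI: "poly q z \<in> A" if "set (coeffs q) \<subseteq> K" for q
    using that by (auto simp: A_def poly_ring_def)
  have AR: "A \<subseteq> R"
    using R(2) by (simp add: A_def)
  have A: "is_subring A"
    unfolding A_def by (rule is_subring_poly_ring[OF Kr])
  have zA: "z \<in> A" and KA: "K \<subseteq> A"
    unfolding A_def by (rule generator_in_poly_ring[OF Kr], rule subset_poly_ring)
  note MI = is_prime_idealD(1)[OF M]
  \<comment> \<open>The contraction of \<open>M\<close> to \<open>K[z]\<close>, on the level of
    polynomials; an element \<open>g\<close> of least degree generates it.\<close>
  define J where "J = {q. set (coeffs q) \<subseteq> K \<and> poly q z \<in> M}"
  have "\<exists>q. q \<in> J \<and> q \<noteq> 0"
    using a0 by (auto simp: J_def poly_ring_def)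
  then obtain g where g: "g \<in> J" "g \<noteq> 0" and gmin: "\<And>q. q \<in> J \<Longrightarrow> q \<noteq> 0 \<Longrightarrow> degree g \<le> degree q"
    using ex_has_least_nat[of "\<lambda>q. q \<in> J \<and> q \<noteq> 0" _ degree] by blast
  have gK: "set (coeffs g) \<subseteq> K" and gM: "poly g z \<in> M"
    using g(1) by (auto simp: J_def)
  define p where "p = poly g z"
  have pA: "p \<in> A"
    unfolding p_def by (rule AI[OF gK])
  have pnz: "p \<noteq> 0"
    using z gK g(2) by (auto simp: p_def transcendental_over_def)
  \<comment> \<open>A constant \<open>g\<close> would be a unit inside \<open>M\<close>. Positive
    degree makes degrees drop when factors \<open>p\<close> are split off in
    \<open>mult\<close>.\<close>
  have dg: "degree g > 0"
  proof (rule ccontr)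
    assume "\<not> degree g > 0"
    then obtain c where c: "g = [:c:]" "c \<noteq> 0"
      using g(2) by (auto elim: degree_eq_zeroE)
    then have cK: "c \<in> K" "c \<in> M"
      using gK gM by (auto simp: cCons_def)
    have "inverse c \<in> K"
      using K(1) cK(1) by (simp add: is_subfield_def inverse_eq_divide)
    then have "inverse c * c \<in> M"
      using cK(2) is_idealD(4)[OF MI] KA AR by blast
    then show False
      using c(2) is_prime_idealD(2)[OF M] by simp
  qed
  have gen: "\<exists>s. set (coeffs s) \<subseteq> K \<and> q = g * s" if q: "q \<in> J" for q
  proof -
    obtain s r where sr: "set (coeffs s) \<subseteq> K" "set (coeffs r) \<subseteq> K" "q = g * s + r" "r = 0 \<or> degree r < degree g"
      using coeffs_subset_division[OF K(1) gK g(2), of q] q unfolding J_def by blast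
    have "poly r z = poly q z - poly s z * poly g z"
      by (simp add: sr(3))
    also have "\<dots> \<in> M"
      using q gM AI[OF sr(1)] AR by (intro is_ideal_diff[OF R(1) MI] is_idealD(4)[OF MI]) (auto simp: J_def)
    finally have "r \<in> J"
      using sr(2) by (simp add: J_def)
    then have "r = 0"
      using sr(4) gmin by fastforce
    then show ?thesis
      using sr by auto
  qed
  have mult: "\<exists>e. \<exists>c\<in>A - M. poly q z = p ^ e * c" if "set (coeffs q) \<subseteq> K" "q \<noteq> 0" for q
    using that
  proof (induction "degree q" arbitrary: q rule: less_induct)
    case less
    show ?case
    proof (cases "q \<in> J")
      case True
      then obtain s where s: "set (coeffs s) \<subseteq> K" "q = g * s"
        using gen by blast
      then have "s \<noteq> 0"
        using less.prems(2) by auto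
      then have "degree s < degree q"
        using g(2) dg by (simp add: s(2) degree_mult_eq)
      then obtain e c where "c \<in> A - M" "poly s z = p ^ e * c"
        using less.hyps s(1) \<open>s \<noteq> 0\<close> by blast
      then have "poly q z = p ^ Suc e * c"
        by (simp add: s(2) p_def)
      then show ?thesis
        using \<open>c \<in> A - M\<close> by blast
    next
      case False
      then show ?thesis
        using less.prems AI[of q] by (intro exI[of _ 0] bexI[of _ "poly q z"]) (auto simp: J_def)
    qed
  qed
  \<comment> \<open>Pigeonhole: only finitely many remainders modulo \<open>g\<close> exist, so two
    of the powers \<open>z ^ (2 ^ i)\<close> agree modulo \<open>M\<close>. Their difference is a
    power of \<open>z ^ (2 ^ (j - i)) - z\<close>, and \<open>M\<close> is prime.\<close>
  obtain N where N: "N > 0" "z ^ (2 ^ N) - z \<in> M"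
  proof -
    define S where "S = {r. set (coeffs r) \<subseteq> K \<and> (r = 0 \<or> degree r < degree g)}"
    have "\<exists>r. r \<in> S \<and> z ^ i - poly r z \<in> M" for i
    proof -
      have "set (coeffs (monom 1 i)) \<subseteq> K"
        using is_subringD(1,2)[OF Kr] by (simp add: coeffs_subset_iff)
      then obtain s r where sr: "set (coeffs s) \<subseteq> K" "set (coeffs r) \<subseteq> K" "monom 1 i = g * s + r"
          "r = 0 \<or> degree r < degree g"
        using coeffs_subset_division[OF K(1) gK g(2)] by blast
      have "z ^ i = poly (monom 1 i) z"
        by (simp add: poly_monom)
      then have "z ^ i - poly r z = poly s z * p"
        by (simp add: sr(3) p_def)
      then have "z ^ i - poly r z \<in> M"
        using gM AI[OF sr(1)] AR is_idealD(4)[OF MI] by (auto simp: p_def)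
      then show ?thesis
        using sr by (auto simp: S_def)
    qed
    then obtain \<phi> where \<phi>: "\<And>i. \<phi> i \<in> S" "\<And>i. z ^ i - poly (\<phi> i) z \<in> M"
      by metis
    have "finite S"
      unfolding S_def by (rule finite_coeffs_subset_degree[OF finK])
    moreover have "range (\<lambda>i. \<phi> (2 ^ i)) \<subseteq> S"
      using \<phi>(1) by blast
    ultimately have "\<not> inj (\<lambda>i::nat. \<phi> (2 ^ i))"
      using finite_subset range_inj_infinite by blast
    then obtain i j where "i < j" "\<phi> (2 ^ i) = \<phi> (2 ^ j)"
      unfolding inj_on_def by (metis linorder_neqE_nat)
    then have "z ^ (2 ^ j) - z ^ (2 ^ i) \<in> M"
      using is_ideal_diff[OF R(1) MI \<phi>(2)[of "2 ^ j"] \<phi>(2)[of "2 ^ i"]] by simp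
    moreover have "z ^ (2 ^ j) = (z ^ (2 ^ (j - i))) ^ (2 ^ i)"
      using \<open>i < j\<close> by (simp add: power_add[symmetric] power_mult[symmetric])
    ultimately have "(z ^ (2 ^ (j - i)) - z) ^ (2 ^ i) \<in> M"
      by (simp add: char2_diff[OF two] char2_power_add[OF two])
    moreover have "z ^ (2 ^ (j - i)) - z \<in> R"
      using zA AR is_subring_power[OF R(1)] is_subringD(4)[OF R(1)] by blast
    ultimately have "z ^ (2 ^ (j - i)) - z \<in> M"
      using is_prime_ideal_power[OF R(1) M] by blast
    then show ?thesis
      using that[of "j - i"] \<open>i < j\<close> by simp
  qed
  define I where "I = (*) p ` R"
  have I: "is_ideal R I"
    unfolding I_def using pA AR by (intro is_ideal_principal[OF R(1)]) auto
  \<comment> \<open>An element of \<open>K[z]\<close> in \<open>M\<close> is a multiple of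
    \<open>p\<close>, so the congruence modulo \<open>M\<close> sharpens to one modulo
    \<open>p\<close>.\<close>
  have zI: "z ^ (2 ^ N) - z \<in> I"
  proof -
    have q: "set (coeffs (monom 1 (2 ^ N) - [:0, 1:])) \<subseteq> K"
      using is_subringD(1,2)[OF Kr]
      by (intro coeffs_subset_add[OF Kr]) (auto simp: coeffs_subset_iff cCons_def)
    have "poly (monom 1 (2 ^ N) - [:0, 1:]) z = z ^ (2 ^ N) - z"
      by (simp add: poly_monom)
    then have "monom 1 (2 ^ N) - [:0, 1:] \<in> J"
      using q N(2) by (simp add: J_def)
    then obtain s where "set (coeffs s) \<subseteq> K" "monom 1 (2 ^ N) - [:0, 1:] = g * s"
      using gen by blast
    then have "z ^ (2 ^ N) - z = p * poly s z" "poly s z \<in> R"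
      using \<open>poly (monom 1 (2 ^ N) - [:0, 1:]) z = z ^ (2 ^ N) - z\<close> AI AR by (auto simp: p_def)
    then show ?thesis
      by (auto simp: I_def)
  qed
  \<comment> \<open>The generator \<open>z\<close> is fixed modulo \<open>p\<close> by the
    \<open>N\<close>-th iterate and \<open>K\<close> by the \<open>h\<close>-th, so
    \<open>N * h\<close> serves both.\<close>
  have "z \<in> {a \<in> R. a ^ (2 ^ (N * h)) - a \<in> I}"
    using frobenius_fixed_iterate[OF two R(1) I zI] zA AR by auto
  moreover have "K \<subseteq> {a \<in> R. a ^ (2 ^ (N * h)) - a \<in> I}"
  proof
    fix c assume c: "c \<in> K"
    then have "c ^ (2 ^ h) - c \<in> I"
      using power_card_subfield[OF K(1) finK c] K(2) is_idealD(2)[OF I] by simp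
    then show "c \<in> {a \<in> R. a ^ (2 ^ (N * h)) - a \<in> I}"
      using frobenius_fixed_iterate[OF two R(1) I, of c h N] c KA AR by (auto simp: mult.commute)
  qed
  ultimately have "A \<subseteq> {a \<in> R. a ^ (2 ^ (N * h)) - a \<in> I}"
    unfolding A_def by (intro poly_ring_subset is_subring_frobenius_fixed[OF two R(1) I])
  then have frob: "\<forall>a\<in>A. a ^ (2 ^ (N * h)) - a \<in> I"
    by blast
  have "\<exists>e. \<exists>c\<in>A - M. a = p ^ e * c" if "a \<in> A" "a \<noteq> 0" for a
  proof -
    obtain q where q: "set (coeffs q) \<subseteq> K" "a = poly q z"
      using \<open>a \<in> A\<close> by (auto simp: A_def poly_ring_def)
    then have "q \<noteq> 0"
      using \<open>a \<noteq> 0\<close> by auto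
    then show ?thesis
      using mult q by simp
  qed
  moreover have "p \<in> M" "N * h > 0"
    using gM N(1) K(3) by (simp_all add: p_def)
  ultimately show ?thesis
    using that[of p "N * h", folded A_def I_def] pA pnz frob by blast
qed

section \<open>Discrete valuations of principal primes\<close>

text \<open>The assumption \<open>fact\<close> says that in the localisation of \<open>R\<close> at
  \<open>M\<close> every nonzero element is a power of \<open>p\<close> times a unit. The
  localisation is thus a discrete valuation ring, and \<open>v\<close> is the exponent of
  \<open>p\<close>.\<close>

lemma place_of_principal_prime:
  fixes R :: "'a::field set"
  assumes R: "is_subring R" and M: "is_prime_ideal R M" and p: "p \<in> M" "p \<noteq> 0"
    and K: "is_subfield K" "K \<subseteq> R" and frac: "fraction_field R = UNIV"
    and fact: "\<And>r. r \<in> R \<Longrightarrow> r \<noteq> 0 \<Longrightarrow> \<exists>e. \<exists>a\<in>R - M. \<exists>b\<in>R - M. b * r = p ^ e * a"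
  obtains v where "place K v" "\<And>r. r \<in> R \<Longrightarrow> 0 \<le> v r"
    "\<And>f. f \<noteq> 0 \<Longrightarrow> 0 \<le> v f \<Longrightarrow> \<exists>s\<in>R - M. s * f \<in> R"
proof -
  define U where "U = R - M"
  note MI = is_prime_idealD(1)[OF M]
  have UR: "a \<in> R" if "a \<in> U" for a
    using that by (simp add: U_def)
  have U0: "a \<noteq> 0" if "a \<in> U" for a
    using that is_idealD(2)[OF MI] by (auto simp: U_def)
  have U1: "1 \<in> U"
    using is_prime_idealD(2)[OF M] is_subringD(2)[OF R] by (simp add: U_def)
  have Umult: "a * b \<in> U" if "a \<in> U" "b \<in> U" for a b
    using that is_prime_idealD(3)[OF M] is_subringD(5)[OF R] by (auto simp: U_def)
  have pR: "p \<in> R"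
    using is_idealD(1)[OF MI p(1)] .
  have pM: "p ^ Suc i * a \<notin> U" if "a \<in> R" for i a
  proof -
    have "(p ^ i * a) * p \<in> M"
      using that p(1) pR is_subring_power[OF R] is_subringD(5)[OF R] by (intro is_idealD(4)[OF MI]) auto
    then show ?thesis
      by (simp add: U_def mult_ac)
  qed
  \<comment> \<open>The relation \<open>rep f e\<close> says that \<open>f\<close> is
    \<open>p\<close> to the power \<open>e\<close> times a unit \<open>a / b\<close> of the
    localisation; \<open>e\<close> may be negative.\<close>
  define rep where "rep f e \<longleftrightarrow> (\<exists>a\<in>U. \<exists>b\<in>U. b * f = p powi e * a)" for f e
  have repI: "rep f e" if "a \<in> U" "b \<in> U" "b * f = p powi e * a" for a b f e
    using that by (auto simp: rep_def)
  have rep_R: "\<exists>e::nat. rep r (int e)" if "r \<in> R" "r \<noteq> 0" for r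
    using fact[OF that] by (auto simp: rep_def U_def)
  have rep_mult: "rep (f * g) (e + e')" if fg: "rep f e" "rep g e'" for f g e e'
  proof -
    obtain a b a' b' where *: "a \<in> U" "b \<in> U" "a' \<in> U" "b' \<in> U" "b * f = p powi e * a" "b' * g = p powi e' * a'"
      using fg by (auto simp: rep_def)
    have "(b * b') * (f * g) = (b * f) * (b' * g)"
      by (simp add: mult_ac)
    also have "\<dots> = p powi (e + e') * (a * a')"
      using p(2) by (simp add: *(5,6) power_int_add mult_ac)
    finally show ?thesis
      using repI Umult * by blast
  qed
  have rep_inverse: "rep (inverse f) (- e)" if f: "f \<noteq> 0" "rep f e" for f e
  proof -
    obtain a b where *: "a \<in> U" "b \<in> U" "b * f = p powi e * a"
      using f(2) by (auto simp: rep_def)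
    have "a * inverse f = p powi (- e) * b"
      using *(3) f(1) p(2) by (simp add: power_int_minus field_simps)
    then show ?thesis
      using repI * by blast
  qed
  have rep_ex: "\<exists>e. rep f e" if "f \<noteq> 0" for f
  proof -
    obtain r s where rs: "r \<in> R" "s \<in> R" "s \<noteq> 0" "f = r / s"
      using frac UNIV_I[of f] unfolding fraction_field_def by blast
    then have "r \<noteq> 0"
      using that by auto
    then obtain e e' where "rep r e" "rep s e'"
      using rep_R rs by meson
    then have "rep (r * inverse s) (e + - e')"
      using rep_mult rep_inverse rs(3) by blast
    then show ?thesis
      using rs(4) by (auto simp: divide_inverse)
  qed
  \<comment> \<open>Two different exponents would make a positive power of \<open>p\<close> times an
    element of \<open>R\<close> lie outside \<open>M\<close>. Exchanging \<open>e\<close> and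
    \<open>e'\<close> gives uniqueness.\<close>
  have rep_le: "e' \<le> e" if f: "rep f e" "rep f e'" for f e e'
  proof (rule ccontr)
    assume "\<not> e' \<le> e"
    then obtain i where i: "e' = e + int (Suc i)"
      by (metis zle_iff_zadd linorder_not_le zless_iff_Suc_zadd)
    obtain a b a' b' where *: "a \<in> U" "b \<in> U" "a' \<in> U" "b' \<in> U" "b * f = p powi e * a" "b' * f = p powi e' * a'"
      using f by (auto simp: rep_def)
    have "p powi e * (b' * a) = b' * (b * f)"
      by (simp add: *(5))
    also have "\<dots> = b * (b' * f)"
      by simp
    also have "\<dots> = p powi e * (p ^ Suc i * (b * a'))"
    proof -
      have "p powi e' = p powi e * p ^ Suc i"
        unfolding i using power_int_add[of p e "int (Suc i)"] p(2) by (simp only: power_int_of_nat simp_thms)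
      then show ?thesis
        unfolding *(6) by (simp only: mult_ac)
    qed
    finally have "b' * a = p ^ Suc i * (b * a')"
      using p(2) by simp
    then show False
      using pM[of "b * a'" i] Umult * UR by metis
  qed
  \<comment> \<open>The value 0 at \<open>f = 0\<close> is the dummy value prescribed by
    \<open>place\<close>.\<close>
  define v where "v f = (if f = 0 then 0 else THE e. rep f e)" for f
  have v_eq: "v f = e" if "f \<noteq> 0" "rep f e" for f e
    unfolding v_def using that rep_le by (auto intro!: the_equality intro: order.antisym)
  have rep_v: "rep f (v f)" if "f \<noteq> 0" for f
    using rep_ex[OF that] v_eq[OF that] by blast
  have v_R: "0 \<le> v r" if "r \<in> R" for r
  proof (cases "r = 0")
    case False
    then show ?thesis
      using rep_R[OF that False] v_eq[OF False] by force
  qed (simp add: v_def)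
  have v_pow: "v (p powi e) = e" for e
    using p(2) U1 by (intro v_eq repI[of 1 1]) auto
  have v_U: "v a = 0" if "a \<in> U" for a
    using that U0 U1 by (intro v_eq repI[of a 1]) auto
  have v_mult: "v (f * g) = v f + v g" if "f \<noteq> 0" "g \<noteq> 0" for f g
    using that rep_mult rep_v by (intro v_eq) auto
  have int: "\<exists>s\<in>U. s * f \<in> R" if "f \<noteq> 0" "0 \<le> v f" for f
  proof -
    obtain a b where ab: "a \<in> U" "b \<in> U" "b * f = p powi (v f) * a"
      using rep_v[OF \<open>f \<noteq> 0\<close>] by (auto simp: rep_def)
    obtain i where "v f = int i"
      using \<open>0 \<le> v f\<close> nonneg_int_cases by blast
    then have "b * f = p ^ i * a"
      using ab(3) by simp
    then show ?thesis
      using ab UR is_subring_power[OF R pR] is_subringD(5)[OF R] by metis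
  qed
  \<comment> \<open>Dividing by the summand of smaller value reduces the ultrametric inequality to
    \<open>1 + h\<close> with \<open>h\<close> in the localisation.\<close>
  have add_int: "0 \<le> v (1 + h)" if h: "h \<noteq> 0" "1 + h \<noteq> 0" "0 \<le> v h" for h
  proof -
    obtain s where s: "s \<in> U" "s * h \<in> R"
      using int[OF h(1,3)] by blast
    have "s * (1 + h) \<in> R"
      using s UR is_subringD(3)[OF R] by (simp add: distrib_left)
    moreover have "v (s * (1 + h)) = v (1 + h)"
      using v_mult[of s "1 + h"] U0 s h v_U by simp
    ultimately show ?thesis
      using v_R by metis
  qed
  have v_add: "v f \<le> v (f + g)" if fg: "f \<noteq> 0" "g \<noteq> 0" "f + g \<noteq> 0" "v f \<le> v g" for f g
  proof -
    define h where "h = g / f"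
    have "g = f * h" "h \<noteq> 0"
      using fg by (auto simp: h_def)
    then have "0 \<le> v h" and eq: "f + g = f * (1 + h)"
      using fg v_mult[of f h] by (auto simp: distrib_left)
    moreover have "1 + h \<noteq> 0"
      using fg(3) eq by auto
    ultimately show ?thesis
      using add_int[of h] \<open>h \<noteq> 0\<close> v_mult[of f "1 + h"] fg(1) by simp
  qed
  have "place K v"
    unfolding place_def
  proof (intro conjI allI ballI impI)
    show "v 0 = 0"
      by (simp add: v_def)
    show "v (f * g) = v f + v g" if "f \<noteq> 0" "g \<noteq> 0" for f g
      by (rule v_mult[OF that])
    show "min (v f) (v g) \<le> v (f + g)" if "f \<noteq> 0" "g \<noteq> 0" "f + g \<noteq> 0" for f g
      using v_add[of f g] v_add[of g f] that by (cases "v f \<le> v g") (auto simp: add.commute)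
    show "v c = 0" if "c \<in> K" "c \<noteq> 0" for c
    proof -
      have "inverse c \<in> K"
        using K(1) that(1) by (auto simp: is_subfield_def inverse_eq_divide)
      moreover have "v (c * inverse c) = 0"
        using v_U[OF U1] that(2) by simp
      ultimately have "0 \<le> v c" "0 \<le> v (inverse c)" "v c + v (inverse c) = 0"
        using v_R K(2) that v_mult[of c "inverse c"] by auto
      then show ?thesis
        by simp
    qed
    show "surj v"
      using v_pow by (metis surjI)
  qed
  then show ?thesis
    using that v_R int unfolding U_def by blast
qed

text \<open>For \<open>a\<close> in \<open>M\<close>, the congruence modulo \<open>p\<close> makes
  \<open>a * (1 - a ^ (2 ^ N - 1))\<close> a multiple of \<open>p\<close>, and the bracket is
  outside \<open>M\<close>. So \<open>p\<close> divides \<open>a\<close> in the localisation, and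
  factors \<open>p\<close> can be split off \<open>r\<close> until the cofactor leaves
  \<open>M\<close>.\<close>

lemma frobenius_fixed_prime_principal:
  fixes R :: "'a::field set"
  assumes two: "(2::'a) = 0" and R: "is_subring R" and M: "is_prime_ideal R M" and p: "p \<in> M" "p \<noteq> 0"
    and frob: "N > 0" "\<forall>a\<in>R. a ^ (2 ^ N) - a \<in> (*) p ` R"
    and A: "A \<subseteq> R" "\<forall>a\<in>A. a \<noteq> 0 \<longrightarrow> (\<exists>e. \<exists>c\<in>A - M. a = p ^ e * c)"
    and dvd: "\<And>r. r \<in> R \<Longrightarrow> r \<noteq> 0 \<Longrightarrow> \<exists>g\<in>R. r * g \<in> A \<and> r * g \<noteq> 0"
    and r: "r \<in> R" "r \<noteq> 0"
  shows "\<exists>e. \<exists>a\<in>R - M. \<exists>b\<in>R - M. b * r = p ^ e * a"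
proof -
  note MI = is_prime_idealD(1)[OF M]
  have pR: "p \<in> R"
    using is_idealD(1)[OF MI p(1)] .
  \<comment> \<open>The predicate \<open>P e\<close> says that \<open>p ^ e\<close> divides
    \<open>r\<close> in the localisation. Some multiple \<open>r * g\<close> lies in
    \<open>A\<close>, and its finite exponent \<open>i\<close> bounds \<open>e\<close>.\<close>
  define P where "P e \<longleftrightarrow> (\<exists>a\<in>R. \<exists>b\<in>R - M. b * r = p ^ e * a)" for e
  obtain g where g: "g \<in> R" "r * g \<in> A" "r * g \<noteq> 0"
    using dvd[OF r] by blast
  then obtain i c where c: "c \<in> A - M" "r * g = p ^ i * c"
    using A(2) by blast
  have bound: "e \<le> i" if "P e" for e
  proof (rule ccontr)
    assume "\<not> e \<le> i"
    then obtain j where j: "e = i + Suc j"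
      by (metis add_Suc_right less_imp_Suc_add linorder_not_le)
    obtain a b where ab: "a \<in> R" "b \<in> R - M" "b * r = p ^ e * a"
      using \<open>P e\<close> unfolding P_def by blast
    have "p ^ i * (b * c) = b * (r * g)"
      by (simp add: c(2))
    also have "\<dots> = g * (b * r)"
      by simp
    also have "\<dots> = p ^ i * ((g * a * p ^ j) * p)"
      by (simp add: ab(3) j power_add mult_ac)
    finally have "b * c = (g * a * p ^ j) * p"
      using p(2) by simp
    also have "\<dots> \<in> M"
      using g(1) ab(1) pR p(1) is_subringD(5)[OF R] is_subring_power[OF R]
      by (intro is_idealD(4)[OF MI]) auto
    finally show False
      using ab(2) c(1) A(1) is_prime_idealD(3)[OF M] by blast
  qed
  have "P 0"
    using r(1) is_subringD(2)[OF R] is_prime_idealD(2)[OF M] unfolding P_def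
    by (intro bexI[of _ r] bexI[of _ 1]) auto
  then obtain e where e: "P e" "\<And>e'. P e' \<Longrightarrow> e' \<le> e"
    using Nat.ex_has_greatest_nat[of P 0 i] bound by blast
  then obtain a b where ab: "a \<in> R" "b \<in> R - M" "b * r = p ^ e * a"
    unfolding P_def by blast
  have "a \<notin> M"
  proof
    assume aM: "a \<in> M"
    \<comment> \<open>Since \<open>N > 0\<close>, the exponent \<open>2 ^ N - 1 = Suc Q\<close> is
      positive, so \<open>a ^ Suc Q\<close> lies in \<open>M\<close> and \<open>t\<close> below does
      not.\<close>
    define Q :: nat where "Q = 2 ^ N - 2"
    have "2 ^ N = Suc (Suc Q)"
    proof -
      have "(2::nat) ^ N \<ge> 2 ^ 1"
        using frob(1) by (intro power_increasing) auto
      then show ?thesis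
        by (simp add: Q_def)
    qed
    then obtain s where s: "s \<in> R" "a ^ Suc (Suc Q) - a = p * s"
      using frob(2) ab(1) by fastforce
    define t where "t = 1 - a ^ Suc Q"
    have "a ^ Suc Q \<in> M"
      using ideal_power[OF R MI aM] by blast
    have "t \<in> R"
      using is_subringD(2,4)[OF R] is_subring_power[OF R ab(1)] by (simp only: t_def)
    moreover have "t \<notin> M"
    proof
      assume "t \<in> M"
      then have "t + a ^ Suc Q \<in> M"
        using \<open>a ^ Suc Q \<in> M\<close> is_idealD(3)[OF MI] by blast
      then show False
        using is_prime_idealD(2)[OF M] by (simp add: t_def)
    qed
    ultimately have "t * b \<in> R - M"
      using ab(2) is_prime_idealD(3)[OF M] is_subringD(5)[OF R] by blast
    \<comment> \<open>Replacing the denominator \<open>b\<close> by \<open>t * b\<close> gains one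
      more factor \<open>p\<close>, against the maximality of \<open>e\<close>.\<close>
    moreover have "t * b * r = p ^ Suc e * (- s)"
    proof -
      have "t * a = - (p * s)"
        unfolding s(2)[symmetric] by (simp add: t_def algebra_simps)
      have "t * b * r = p ^ e * (t * a)"
        by (simp add: mult.assoc ab(3))
      then show ?thesis
        unfolding \<open>t * a = - (p * s)\<close> by simp
    qed
    ultimately have "P (Suc e)"
      using is_subring_uminus[OF R s(1)] unfolding P_def by blast
    then show False
      using e(2) by fastforce
  qed
  then show ?thesis
    using ab by blast
qed

section \<open>Pole orders in an Artin-Schreier tower\<close>

lemma placeD:
  assumes "place K v"
  shows "v 0 = 0" "f \<noteq> 0 \<Longrightarrow> g \<noteq> 0 \<Longrightarrow> v (f * g) = v f + v g"
    "f \<noteq> 0 \<Longrightarrow> g \<noteq> 0 \<Longrightarrow> f + g \<noteq> 0 \<Longrightarrow> min (v f) (v g) \<le> v (f + g)"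
    "c \<in> K \<Longrightarrow> v c = 0" "surj v"
  using assms unfolding place_def by metis+

lemma place_one: "place K v \<Longrightarrow> v 1 = 0"
  using placeD(2)[of K v 1 1] by simp

lemma place_power:
  assumes "place K v"
  shows "v (f ^ i) = int i * v f"
proof (cases "f = 0")
  case True
  then show ?thesis
    using placeD(1)[OF assms] place_one[OF assms] by (cases i) auto
next
  case False
  then show ?thesis
    by (induction i) (auto simp: place_one[OF assms] placeD(2)[OF assms] algebra_simps)
qed

lemma place_divide:
  assumes "place K v" "f \<noteq> 0" "g \<noteq> 0"
  shows "v (f / g) = v f - v g"
  using placeD(2)[OF assms(1), of "f / g" g] assms(2,3) by simp

lemma place_uminus:
  assumes "place K v"
  shows "v (- f) = v f"
proof (cases "f = 0")
  case False
  have "v (- 1) + v (- 1) = v ((- 1) * (- 1))"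
    by (rule placeD(2)[OF assms, symmetric]) auto
  then have "v (- 1) = 0"
    using place_one[OF assms] by simp
  then show ?thesis
    using placeD(2)[OF assms, of "- 1" f] False by simp
qed simp

text \<open>The ultrametric inequality applied to \<open>f = (f + g) - g\<close> gives equality. The
  case \<open>g = 0\<close>, where \<open>v g\<close> is the dummy 0, is immediate.\<close>

lemma place_add_less:
  assumes v: "place K v" and fg: "f \<noteq> 0" "v f < v g"
  shows "f + g \<noteq> 0" "v (f + g) = v f"
proof -
  show nz: "f + g \<noteq> 0"
  proof
    assume "f + g = 0"
    then have "g = - f"
      by (simp add: eq_neg_iff_add_eq_0 add.commute)
    then show False
      using place_uminus[OF v] fg(2) by simp
  qed
  show "v (f + g) = v f"
  proof (cases "g = 0")
    case False
    have "min (v (f + g)) (v (- g)) \<le> v ((f + g) + - g)"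
      using nz fg(1) False by (intro placeD(3)[OF v]) auto
    then show ?thesis
      using placeD(3)[OF v fg(1) False nz] fg(2) place_uminus[OF v] by simp
  qed simp
qed

text \<open>At a pole of \<open>t\<close> the square dominates; without a pole of \<open>t\<close>
  the sum has none either.\<close>

lemma place_artin_schreier:
  assumes v: "place K v"
  shows "v t < 0 \<Longrightarrow> v (t\<^sup>2 + t) = 2 * v t" "v (t\<^sup>2 + t) < 0 \<longleftrightarrow> v t < 0"
proof -
  show *: "v (t\<^sup>2 + t) = 2 * v t" if "v t < 0"
  proof -
    have "t \<noteq> 0"
      using that placeD(1)[OF v] by auto
    then show ?thesis
      using place_add_less(2)[OF v, of "t\<^sup>2" t] place_power[OF v, of t 2] that by simp
  qed
  have "0 \<le> v (t\<^sup>2 + t)" if "0 \<le> v t"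
  proof (cases "t = 0 \<or> t\<^sup>2 + t = 0")
    case True
    then show ?thesis
      using placeD(1)[OF v] by auto
  next
    case False
    then show ?thesis
      using placeD(3)[OF v, of "t\<^sup>2" t] place_power[OF v, of t 2] that by simp
  qed
  then show "v (t\<^sup>2 + t) < 0 \<longleftrightarrow> v t < 0"
    using * by force
qed

lemma is_subring_valuation_ring:
  assumes v: "place K v"
  shows "is_subring {f. 0 \<le> v f}"
proof -
  have add: "0 \<le> v (f + g)" if "0 \<le> v f" "0 \<le> v g" for f g
    using placeD(1)[OF v] placeD(3)[OF v, of f g] that
    by (cases "f = 0 \<or> g = 0 \<or> f + g = 0") auto
  have "0 \<le> v (f * g)" if "0 \<le> v f" "0 \<le> v g" for f g
    using placeD(1)[OF v] placeD(2)[OF v, of f g] that by (cases "f = 0 \<or> g = 0") auto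
  then show ?thesis
    using add add[of _ "- _"] placeD(1)[OF v] place_one[OF v] place_uminus[OF v]
    by (auto simp: is_subring_def)
qed

text \<open>At a pole of \<open>z\<close> the top term dominates, because the coefficients have
  value 0; the induction follows Horner's scheme.\<close>

lemma place_poly_ring:
  assumes v: "place K v" and K: "0 \<in> K" and z: "v z < 0"
    and q: "set (coeffs q) \<subseteq> K" "q \<noteq> 0"
  shows "poly q z \<noteq> 0 \<and> v (poly q z) = int (degree q) * v z"
  using q
proof (induction q)
  case (pCons c q)
  have znz: "z \<noteq> 0"
    using z placeD(1)[OF v] by auto
  have c: "c \<in> K"
    using pCons.prems pCons.hyps by (auto simp: cCons_def split: if_splits)
  show ?case
  proof (cases "q = 0")
    case True
    then show ?thesis
      using pCons.prems c placeD(4)[OF v] by auto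
  next
    case False
    moreover have "set (coeffs q) \<subseteq> K"
      using pCons.prems(1) False by (auto simp: cCons_def)
    ultimately have IH: "poly q z \<noteq> 0" "v (poly q z) = int (degree q) * v z"
      using pCons.IH by auto
    then have *: "z * poly q z \<noteq> 0" "v (z * poly q z) = int (Suc (degree q)) * v z"
      using znz placeD(2)[OF v] by (auto simp: algebra_simps)
    then have "v (z * poly q z) < v c"
      using z placeD(4)[OF v c] by (auto simp: mult_pos_neg)
    then show ?thesis
      using place_add_less[OF v *(1), of c] *(2) False by (simp add: add.commute)
  qed
qed simp

text \<open>Two valuations are treated at once, to show later that they coincide.\<close>

lemma place_adjoin:
  assumes v: "place K v" and v': "place K v'" and b: "(b::int) > 0" "(b'::int) > 0"
    and A: "\<And>a. a \<in> A \<Longrightarrow> a \<noteq> 0 \<Longrightarrow> \<exists>s\<in>S. v a = - b * int s \<and> v' a = - b' * int s"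
    and t: "t \<noteq> 0" "v t = - b * int \<tau>" "v' t = - b' * int \<tau>"
    and disj: "\<And>s s'. s \<in> S \<Longrightarrow> s' \<in> S \<Longrightarrow> s \<noteq> s' + \<tau>"
    and f: "f \<in> adjoin A t" "f \<noteq> 0"
  shows "\<exists>s\<in>S \<union> (\<lambda>s. s + \<tau>) ` S. v f = - b * int s \<and> v' f = - b' * int s"
proof -
  obtain a c where ac: "a \<in> A" "c \<in> A" "f = a + c * t"
    using f(1) by (auto simp: adjoin_def)
  have C: "\<exists>s\<in>S. v (c * t) = - b * int (s + \<tau>) \<and> v' (c * t) = - b' * int (s + \<tau>)" if "c \<noteq> 0"
    using A[OF ac(2) that] placeD(2)[OF v that t(1)] placeD(2)[OF v' that t(1)] t(2,3)
    by (auto simp: algebra_simps)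
  consider "a = 0" | "a \<noteq> 0" "c = 0" | "a \<noteq> 0" "c \<noteq> 0"
    by blast
  then show ?thesis
  proof cases
    case 1
    then have "f = c * t" "c \<noteq> 0"
      using f(2) ac(3) by auto
    then show ?thesis
      using C by blast
  next
    case 2
    then show ?thesis
      using A[OF ac(1)] ac(3) by auto
  next
    case 3
    obtain s s' where s: "s \<in> S" "s' \<in> S" "v a = - b * int s" "v' a = - b' * int s"
      "v (c * t) = - b * int (s' + \<tau>)" "v' (c * t) = - b' * int (s' + \<tau>)"
      using A[OF ac(1) 3(1)] C[OF 3(2)] by blast
    have ct: "c * t \<noteq> 0"
      using 3 t(1) by simp
    show ?thesis
    \<comment> \<open>By \<open>disj\<close> the pole orders of \<open>a\<close> and
      \<open>c * t\<close> differ. The larger one wins, and the comparison of \<open>s\<close> with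
      \<open>s' + \<tau>\<close> decides it for \<open>v\<close> and \<open>v'\<close>
      alike.\<close>
    proof (cases "s < s' + \<tau>")
      case True
      have less: "- e * int (s' + \<tau>) < - e * int s" if "e > 0" for e
        using that True by (simp del: of_nat_add)
      have "v f = v (c * t)" "v' f = v' (c * t)"
        unfolding ac(3) add.commute[of a]
        by (intro place_add_less(2)[OF v ct] place_add_less(2)[OF v' ct]; simp only: s less b)+
      then have "v f = - b * int (s' + \<tau>) \<and> v' f = - b' * int (s' + \<tau>)"
        by (simp only: s(5,6))
      then show ?thesis
        using s(2) by blast
    next
      case False
      then have "s' + \<tau> < s"
        using disj[OF s(1,2)] by simp
      then have less: "- e * int s < - e * int (s' + \<tau>)" if "e > 0" for e
        using that by (simp del: of_nat_add)
      have "v f = v a" "v' f = v' a"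
        unfolding ac(3)
        by (intro place_add_less(2)[OF v 3(1)] place_add_less(2)[OF v' 3(1)]; simp only: s less b)+
      then show ?thesis
        using s by fastforce
    qed
  qed
qed

lemma place_adjoin_attained:
  assumes v: "place K v" and A: "is_subring A"
    and att: "\<And>s. s \<in> S \<Longrightarrow> \<exists>a\<in>A. a \<noteq> 0 \<and> v a = - int s"
    and t: "t \<noteq> 0" "v t = - int \<tau>"
    and s: "s \<in> S \<union> (\<lambda>s. s + \<tau>) ` S"
  shows "\<exists>a\<in>adjoin A t. a \<noteq> 0 \<and> v a = - int s"
  using s
proof
  assume "s \<in> S"
  then show ?thesis
    using att subset_adjoin[OF A] by blast
next
  assume "s \<in> (\<lambda>s. s + \<tau>) ` S"
  then obtain s' a where a: "s = s' + \<tau>" "a \<in> A" "a \<noteq> 0" "v a = - int s'"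
    using att by blast
  have "a * t \<in> adjoin A t"
    using a(2) is_subringD(1)[OF A] unfolding adjoin_def by force
  moreover have "a * t \<noteq> 0" "v (a * t) = - int s"
    using a t placeD(2)[OF v] by auto
  ultimately show ?thesis
    by blast
qed

section \<open>Fraction fields and poles at finite places\<close>

lemma is_subfield_fraction_field:
  assumes R: "is_subring R"
  shows "is_subfield (fraction_field R)" "R \<subseteq> fraction_field R"
proof -
  have I: "a / b \<in> fraction_field R" if "a \<in> R" "b \<in> R" "b \<noteq> 0" for a b
    using that by (auto simp: fraction_field_def)
  show sub: "R \<subseteq> fraction_field R"
    using I[OF _ is_subringD(2)[OF R]] by fastforce
  have "f + g \<in> fraction_field R \<and> f - g \<in> fraction_field R \<and> f * g \<in> fraction_field R \<and> f / g \<in> fraction_field R"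
    if fg: "f \<in> fraction_field R" "g \<in> fraction_field R" for f g
  proof -
    obtain a b c d where *: "a \<in> R" "b \<in> R" "b \<noteq> 0" "c \<in> R" "d \<in> R" "d \<noteq> 0" "f = a / b" "g = c / d"
      using fg by (auto simp: fraction_field_def)
    have "f + g = (a * d + c * b) / (b * d)" "f - g = (a * d - c * b) / (b * d)"
      "f * g = (a * c) / (b * d)" "f / g = (a * d) / (b * c)"
      using * by (auto simp: field_simps)
    moreover have "(a * d + c * b) / (b * d) \<in> fraction_field R" "(a * d - c * b) / (b * d) \<in> fraction_field R"
      "(a * c) / (b * d) \<in> fraction_field R"
      using * is_subringD[OF R] by (intro I; simp)+
    moreover have "(a * d) / (b * c) \<in> fraction_field R"
    proof (cases "c = 0")
      case True
      then show ?thesis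
        using sub is_subringD(1)[OF R] by auto
    next
      case False
      then show ?thesis
        using * is_subringD[OF R] by (intro I) simp_all
    qed
    ultimately show ?thesis
      by simp
  qed
  then show "is_subfield (fraction_field R)"
    using sub is_subringD(1,2)[OF R] unfolding is_subfield_def by blast
qed

text \<open>The denominators of \<open>f\<close> form a proper ideal of \<open>R\<close>. At the
  place of a prime \<open>M\<close> above it \<open>f\<close> has a pole: otherwise \<open>f\<close>
  would have a denominator outside \<open>M\<close>.\<close>

lemma exists_place_with_pole:
  fixes R :: "'a::field set"
  assumes two: "(2::'a) = 0" and K: "is_subfield K" "card K = 2 ^ h" "h > 0" and z: "transcendental_over K z"
    and R: "is_subring R" "poly_ring K z \<subseteq> R" and frac: "fraction_field R = UNIV"
    and dvd: "\<And>r. r \<in> R \<Longrightarrow> r \<noteq> 0 \<Longrightarrow> \<exists>g\<in>R. r * g \<in> poly_ring K z \<and> r * g \<noteq> 0"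
    and frob: "\<And>I N. is_ideal R I \<Longrightarrow> N > 0 \<Longrightarrow> \<forall>a\<in>poly_ring K z. a ^ (2 ^ N) - a \<in> I \<Longrightarrow>
      \<exists>N'>0. \<forall>a\<in>R. a ^ (2 ^ N') - a \<in> I"
    and f: "f \<notin> R"
  obtains v where "place K v" "\<And>r. r \<in> R \<Longrightarrow> 0 \<le> v r" "v f < 0"
proof -
  define I where "I = {r \<in> R. r * f \<in> R}"
  have "is_ideal R I"
    using is_subringD[OF R(1)] by (auto simp: is_ideal_def I_def algebra_simps)
  moreover have "1 \<notin> I"
    using f by (simp add: I_def)
  ultimately obtain M where M: "is_prime_ideal R M" "I \<subseteq> M"
    using exists_prime_ideal_superset[OF R(1)] by blast
  have "f \<in> fraction_field R"
    by (simp add: frac)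
  then obtain a b where ab: "a \<in> R" "b \<in> R" "b \<noteq> 0" "f = a / b"
    by (auto simp: fraction_field_def)
  then obtain g where g: "g \<in> R" "b * g \<in> poly_ring K z" "b * g \<noteq> 0"
    using dvd by blast
  \<comment> \<open>Multiplying the denominator \<open>b\<close> down to \<open>K[z]\<close> gives a
    nonzero element of \<open>K[z]\<close> in \<open>M\<close>, as needed to find
    \<open>p\<close>.\<close>
  have eq: "b * g * f = a * g"
    using ab by simp
  have "b * g \<in> I"
    using g(1,2) R(2) is_subringD(5)[OF R(1) ab(1)] unfolding I_def mem_Collect_eq eq by blast
  then obtain p N where p: "p \<in> poly_ring K z" "p \<in> M" "p \<noteq> 0" and N: "N > 0"
    and mult: "\<forall>a\<in>poly_ring K z. a \<noteq> 0 \<longrightarrow> (\<exists>e. \<exists>c\<in>poly_ring K z - M. a = p ^ e * c)"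
    and fr: "\<forall>a\<in>poly_ring K z. a ^ (2 ^ N) - a \<in> (*) p ` R"
    using poly_ring_prime_generator[OF two K R z M(1) g(2) _ g(3)] M(2) by blast
  have pI: "is_ideal R ((*) p ` R)"
    using p(1) R(2) by (intro is_ideal_principal[OF R(1)]) auto
  obtain N' where N': "N' > 0" "\<forall>a\<in>R. a ^ (2 ^ N') - a \<in> (*) p ` R"
    using frob[OF pI N fr] by blast
  have KR: "K \<subseteq> R"
    using subset_poly_ring R(2) by blast
  obtain v where v: "place K v" "\<And>r. r \<in> R \<Longrightarrow> 0 \<le> v r"
      "\<And>f. f \<noteq> 0 \<Longrightarrow> 0 \<le> v f \<Longrightarrow> \<exists>s\<in>R - M. s * f \<in> R"
    using place_of_principal_prime[OF R(1) M(1) p(2,3) K(1) KR frac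
        frobenius_fixed_prime_principal[OF two R(1) M(1) p(2,3) N' R(2) mult dvd]]
    by blast
  have "\<not> 0 \<le> v f"
  proof
    assume "0 \<le> v f"
    moreover have "f \<noteq> 0"
      using f is_subringD(1)[OF R(1)] by auto
    ultimately obtain s where "s \<in> R - M" "s * f \<in> R"
      using v(3) by blast
    then show False
      using M(2) by (auto simp: I_def)
  qed
  then show ?thesis
    using that v(1,2) by force
qed

section \<open>The Weierstrass semigroup\<close>

text \<open>This is the coordinate ring \<open>K[x, y, z]\<close>, written so that each step adjoins
  a root of an Artin-Schreier equation over the previous ring.\<close>

definition GGS2_ring :: "'a::field set \<Rightarrow> 'a \<Rightarrow> 'a \<Rightarrow> 'a \<Rightarrow> 'a set" where
  "GGS2_ring K x y z = adjoin (adjoin (adjoin (poly_ring K z) (y\<^sup>2 + y)) y) x"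

text \<open>If \<open>S\<close> contains the pole orders on \<open>A\<close> and \<open>t\<close>
  has pole order \<open>\<tau>\<close>, these are the possible pole orders of
  \<open>a + b * t\<close> without cancellation.\<close>

definition shift_union :: "nat set \<Rightarrow> nat \<Rightarrow> nat set" where
  "shift_union S \<tau> = S \<union> (\<lambda>s. s + \<tau>) ` S"

text \<open>The set of all \<open>3im + 2jm + 8k\<close>: the binary digits of \<open>j\<close> give
  the shifts \<open>4 * m\<close> and \<open>2 * m\<close>, and \<open>i\<close> gives
  \<open>3 * m\<close>.\<close>

definition GGS2_semigroup :: "nat \<Rightarrow> nat set" where
  "GGS2_semigroup m = shift_union (shift_union (shift_union (range ((*) 8)) (4 * m)) (2 * m)) (3 * m)"

lemma artin_schreier_square:
  fixes y :: "'a::comm_ring_1"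
  assumes "(2::'a) = 0" "y ^ 4 - y = u"
  shows "(y\<^sup>2 + y)\<^sup>2 + (y\<^sup>2 + y) = u"
proof -
  have "(y\<^sup>2 + y)\<^sup>2 + (y\<^sup>2 + y) = y ^ 4 - y + 2 * (y ^ 3 + y\<^sup>2 + y)"
    by (simp add: power2_eq_square power3_eq_cube power4_eq_xxxx algebra_simps)
  then show ?thesis
    using assms by simp
qed

lemma GGS2_ring_tower:
  fixes K :: "'a::field set"
  assumes two: "(2::'a) = 0" and K: "is_subring K" and c: "x\<^sup>2 + x = y ^ 3" "y ^ 4 - y = z ^ m"
  shows "(y\<^sup>2 + y)\<^sup>2 + (y\<^sup>2 + y) = z ^ m"
    "(y\<^sup>2 + y)\<^sup>2 + (y\<^sup>2 + y) \<in> poly_ring K z"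
    "is_subring (poly_ring K z)"
    "is_subring (adjoin (poly_ring K z) (y\<^sup>2 + y))"
    "y\<^sup>2 + y \<in> adjoin (poly_ring K z) (y\<^sup>2 + y)"
    "is_subring (adjoin (adjoin (poly_ring K z) (y\<^sup>2 + y)) y)"
    "x\<^sup>2 + x \<in> adjoin (adjoin (poly_ring K z) (y\<^sup>2 + y)) y"
    "is_subring (GGS2_ring K x y z)"
    "poly_ring K z \<subseteq> GGS2_ring K x y z"
    "K \<union> {x, y, z} \<subseteq> GGS2_ring K x y z"
proof -
  define A where "A = poly_ring K z"
  define B where "B = adjoin A (y\<^sup>2 + y)"
  define C where "C = adjoin B y"
  show w: "(y\<^sup>2 + y)\<^sup>2 + (y\<^sup>2 + y) = z ^ m"
    by (rule artin_schreier_square[OF two c(2)])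
  show A: "is_subring A"
    unfolding A_def by (rule is_subring_poly_ring[OF K])
  have zA: "z \<in> A"
    unfolding A_def by (rule generator_in_poly_ring[OF K])
  show wA: "(y\<^sup>2 + y)\<^sup>2 + (y\<^sup>2 + y) \<in> A"
    unfolding w by (rule is_subring_power[OF A zA])
  show B: "is_subring B"
    unfolding B_def by (rule is_subring_adjoin[OF A wA])
  show yB: "y\<^sup>2 + y \<in> B"
    unfolding B_def by (rule generator_in_adjoin[OF A])
  show C: "is_subring C"
    unfolding C_def by (rule is_subring_adjoin[OF B yB])
  have yC: "y \<in> C"
    unfolding C_def by (rule generator_in_adjoin[OF B])
  show xC: "x\<^sup>2 + x \<in> C"
    unfolding c(1) by (rule is_subring_power[OF C yC])
  have R: "GGS2_ring K x y z = adjoin C x"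
    by (simp add: GGS2_ring_def C_def B_def A_def)
  show "is_subring (GGS2_ring K x y z)"
    unfolding R by (rule is_subring_adjoin[OF C xC])
  have "A \<subseteq> B"
    unfolding B_def by (rule subset_adjoin[OF A])
  moreover have "B \<subseteq> C"
    unfolding C_def by (rule subset_adjoin[OF B])
  moreover have "C \<subseteq> adjoin C x"
    by (rule subset_adjoin[OF C])
  ultimately show "A \<subseteq> GGS2_ring K x y z" "K \<union> {x, y, z} \<subseteq> GGS2_ring K x y z"
    using yC zA generator_in_adjoin[OF C, of x] subset_poly_ring[of K z] unfolding R A_def by blast+
qed

lemma GGS2_ring_subset:
  assumes R: "is_subring R" and "K \<subseteq> R" "x \<in> R" "y \<in> R" "z \<in> R"
  shows "GGS2_ring K x y z \<subseteq> R"
  unfolding GGS2_ring_def using assms is_subring_power[OF R \<open>y \<in> R\<close>, of 2]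
  by (intro adjoin_subset poly_ring_subset is_subringD(3)[OF R]) auto

text \<open>The equations force a pole of one coordinate to be a pole of all and then fix the ratios
  of the values. Since \<open>v y\<close> is even and \<open>m\<close> is odd, 8 divides
  \<open>v z\<close>, which yields the common factor \<open>b\<close>.\<close>

lemma place_at_infinity_values:
  fixes K :: "'a::field set"
  assumes two: "(2::'a) = 0" and c: "x\<^sup>2 + x = y ^ 3" "y ^ 4 - y = z ^ m"
    and m: "odd m" and v: "place_at_infinity K x y z v"
  obtains b :: int where "b > 0" "v z = - b * int 8" "v (y\<^sup>2 + y) = - b * int (4 * m)"
    "v y = - b * int (2 * m)" "v x = - b * int (3 * m)"
proof -
  have pl: "place K v" and inf: "v x < 0 \<or> v y < 0 \<or> v z < 0"
    using v by (auto simp: place_at_infinity_def)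
  have "m > 0"
    using m by (cases m) auto
  have w: "(y\<^sup>2 + y)\<^sup>2 + (y\<^sup>2 + y) = z ^ m"
    by (rule artin_schreier_square[OF two c(2)])
  have y3: "v (y ^ 3) = 3 * v y" and zm: "v (z ^ m) = int m * v z"
    using place_power[OF pl] by auto
  have xy: "v x < 0 \<longleftrightarrow> v y < 0"
    using place_artin_schreier(2)[OF pl, of x] y3 unfolding c(1) by simp
  have "v z < 0 \<longleftrightarrow> v y < 0"
    using place_artin_schreier(2)[OF pl, of "y\<^sup>2 + y"] place_artin_schreier(2)[OF pl, of y] \<open>m > 0\<close>
    unfolding w zm by (simp add: mult_less_0_iff)
  then have neg: "v x < 0" "v y < 0" "v z < 0"
    using inf xy by auto
  have vx: "3 * v y = 2 * v x"
    using place_artin_schreier(1)[OF pl neg(1)] unfolding c(1) y3 .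
  have vw: "v (y\<^sup>2 + y) = 2 * v y"
    using place_artin_schreier(1)[OF pl neg(2)] .
  have vz: "int m * v z = 4 * v y"
    using place_artin_schreier(1)[OF pl, of "y\<^sup>2 + y"] neg(2) unfolding w zm vw by simp
  obtain d where d: "v y = 2 * d"
  proof -
    have "even (v y)"
      using vx by presburger
    then show ?thesis
      using that by (auto elim: evenE)
  qed
  have "8 dvd int m * v z"
    using vz d by simp
  moreover have "coprime (8::int) (int m)"
  proof -
    have "coprime (2 ^ 3 :: int) (int m)"
      using m by (intro coprime_power_left_iff[THEN iffD2]) auto
    then show ?thesis
      by simp
  qed
  ultimately have "8 dvd v z"
    using coprime_dvd_mult_right_iff by blast
  then obtain e where e: "v z = 8 * e"
    by (auto elim: dvdE)
  have "d = int m * e"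
    using vz d e by simp
  then show ?thesis
    using that[of "- e"] neg(3) e d vx vw by simp
qed

text \<open>The pole orders before the three steps are multiples of 8, 4 and 2. As \<open>m\<close>
  is odd, \<open>4 * m\<close>, \<open>2 * m\<close> and \<open>3 * m\<close> respectively are not,
  so no cancellation occurs.\<close>

lemma place_GGS2_ring:
  fixes K :: "'a::field set"
  assumes v: "place K v" and v': "place K v'" and K: "0 \<in> K" and m: "odd m" and b: "(b::int) > 0" "(b'::int) > 0"
    and b1: "v z = - b * int 8" "v (y\<^sup>2 + y) = - b * int (4 * m)" "v y = - b * int (2 * m)" "v x = - b * int (3 * m)"
    and b2: "v' z = - b' * int 8" "v' (y\<^sup>2 + y) = - b' * int (4 * m)" "v' y = - b' * int (2 * m)" "v' x = - b' * int (3 * m)"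
    and f: "f \<in> GGS2_ring K x y z" "f \<noteq> 0"
  shows "\<exists>s\<in>GGS2_semigroup m. v f = - b * int s \<and> v' f = - b' * int s"
proof -
  have "m > 0"
    using m by (cases m) auto
  have nz: "x \<noteq> 0" "y \<noteq> 0" "y\<^sup>2 + y \<noteq> 0"
    using b(1) b1 placeD(1)[OF v] \<open>m > 0\<close> by auto
  define S where "S = range ((*) (8::nat))"
  define S' where "S' = shift_union S (4 * m)"
  define S'' where "S'' = shift_union S' (2 * m)"
  obtain u where u: "m = 2 * u + 1"
    using m by (auto elim: oddE)
  have S: "8 dvd s" if "s \<in> S" for s
    using that by (auto simp: S_def)
  have S': "4 dvd s" if "s \<in> S'" for s
    using that S by (auto simp: S'_def shift_union_def intro!: dvd_add intro: dvd_trans[of 4 8])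
  have S'': "2 dvd s" if "s \<in> S''" for s
    using that S' by (auto simp: S''_def shift_union_def intro!: dvd_add intro: dvd_trans[of 2 4])
  have A: "\<exists>s\<in>S. v f = - b * int s \<and> v' f = - b' * int s" if "f \<in> poly_ring K z" "f \<noteq> 0" for f
  proof -
    obtain q where q: "set (coeffs q) \<subseteq> K" "f = poly q z"
      using \<open>f \<in> poly_ring K z\<close> by (auto simp: poly_ring_def)
    then have "q \<noteq> 0"
      using \<open>f \<noteq> 0\<close> by auto
    have "v z < 0" "v' z < 0"
      using b b1 b2 by simp_all
    then show ?thesis
      using place_poly_ring[OF v K _ q(1) \<open>q \<noteq> 0\<close>] place_poly_ring[OF v' K _ q(1) \<open>q \<noteq> 0\<close>] b1(1) b2(1)
      by (intro bexI[of _ "8 * degree q"]) (auto simp: S_def q(2))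
  qed
  have "s \<noteq> s' + 4 * m" if "s \<in> S" "s' \<in> S" for s s'
    using S[OF that(1)] S[OF that(2)] u by presburger
  then have B: "\<exists>s\<in>S'. v f = - b * int s \<and> v' f = - b' * int s"
    if "f \<in> adjoin (poly_ring K z) (y\<^sup>2 + y)" "f \<noteq> 0" for f
    unfolding S'_def shift_union_def using place_adjoin[OF v v' b A nz(3) b1(2) b2(2) _ that] by blast
  have "s \<noteq> s' + 2 * m" if "s \<in> S'" "s' \<in> S'" for s s'
    using S'[OF that(1)] S'[OF that(2)] u by presburger
  then have C: "\<exists>s\<in>S''. v f = - b * int s \<and> v' f = - b' * int s"
    if "f \<in> adjoin (adjoin (poly_ring K z) (y\<^sup>2 + y)) y" "f \<noteq> 0" for f
    unfolding S''_def shift_union_def using place_adjoin[OF v v' b B nz(2) b1(3) b2(3) _ that] by blast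
  have "s \<noteq> s' + 3 * m" if "s \<in> S''" "s' \<in> S''" for s s'
    using S''[OF that(1)] S''[OF that(2)] u by presburger
  then show ?thesis
    using place_adjoin[OF v v' b C nz(1) b1(4) b2(4) _ f[unfolded GGS2_ring_def]]
    unfolding GGS2_semigroup_def shift_union_def S''_def S'_def S_def by blast
qed

lemma GGS2_semigroup_attained:
  fixes K :: "'a::field set"
  assumes two: "(2::'a) = 0" and K: "is_subring K" and c: "x\<^sup>2 + x = y ^ 3" "y ^ 4 - y = z ^ m"
    and m: "m > 0" and v: "place K v"
    and b1: "v z = - int 8" "v (y\<^sup>2 + y) = - int (4 * m)" "v y = - int (2 * m)" "v x = - int (3 * m)"
    and s: "s \<in> GGS2_semigroup m"
  shows "\<exists>f\<in>GGS2_ring K x y z. f \<noteq> 0 \<and> v f = - int s"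
proof -
  note tower = GGS2_ring_tower[OF two K c]
  have nz: "x \<noteq> 0" "y \<noteq> 0" "y\<^sup>2 + y \<noteq> 0" "z \<noteq> 0"
    using b1 placeD(1)[OF v] m by auto
  define S where "S = range ((*) (8::nat))"
  define S' where "S' = shift_union S (4 * m)"
  define S'' where "S'' = shift_union S' (2 * m)"
  have A: "\<exists>f\<in>poly_ring K z. f \<noteq> 0 \<and> v f = - int s" if "s \<in> S" for s
  proof -
    obtain i where "s = 8 * i"
      using \<open>s \<in> S\<close> by (auto simp: S_def)
    then show ?thesis
      using is_subring_power[OF tower(3) generator_in_poly_ring[OF K], of i] nz(4) b1(1) place_power[OF v, of z i]
      by (intro bexI[of _ "z ^ i"]) auto
  qed
  have B: "\<exists>f\<in>adjoin (poly_ring K z) (y\<^sup>2 + y). f \<noteq> 0 \<and> v f = - int s" if "s \<in> S'" for s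
    using place_adjoin_attained[OF v tower(3) A nz(3) b1(2)] that by (simp add: S'_def shift_union_def)
  have C: "\<exists>f\<in>adjoin (adjoin (poly_ring K z) (y\<^sup>2 + y)) y. f \<noteq> 0 \<and> v f = - int s" if "s \<in> S''" for s
    using place_adjoin_attained[OF v tower(4) B nz(2) b1(3)] that by (simp add: S''_def shift_union_def)
  have "s \<in> S'' \<union> (\<lambda>s. s + 3 * m) ` S''"
    using s by (simp only: GGS2_semigroup_def shift_union_def S''_def S'_def S_def)
  then show ?thesis
    using place_adjoin_attained[OF v tower(6) C nz(1) b1(4)] by (simp add: GGS2_ring_def)
qed

lemma weierstrass_semigroup_GGS2:
  fixes K :: "'a::field set"
  assumes GGS: "GGS2_function_field n K x y z" and n: "n > 0" and m: "m = (2 ^ n + 1) div 3" "odd m"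
    and P: "place_at_infinity K x y z P"
  shows "weierstrass_semigroup K P = GGS2_semigroup m"
proof -
  have K: "is_subfield K" "card K = 2 ^ (2 * n)" and c: "x\<^sup>2 + x = y ^ 3" "y ^ 4 - y = z ^ m"
    and z: "transcendental_over K z" and gen: "\<And>L. is_subfield L \<Longrightarrow> K \<union> {x, y, z} \<subseteq> L \<Longrightarrow> L = UNIV"
    using GGS m(1) by (auto simp: GGS2_function_field_def)
  have two: "(2::'a) = 0"
    by (rule two_eq_0_if_card_subfield[OF K])
  have Kr: "is_subring K"
    by (rule is_subring_subfield[OF K(1)])
  have "m > 0"
    using m(2) by (cases m) auto
  define R where "R = GGS2_ring K x y z"
  note tower = GGS2_ring_tower[OF two Kr c]
  have R: "is_subring R" "poly_ring K z \<subseteq> R" "K \<union> {x, y, z} \<subseteq> R"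
    unfolding R_def by (fact tower(8), fact tower(9), fact tower(10))
  have frac: "fraction_field R = UNIV"
    using is_subfield_fraction_field[OF R(1)] R(3) by (intro gen) auto
  have PP: "place K P"
    using P by (simp add: place_at_infinity_def)
  \<comment> \<open>Every function is a quotient of elements of \<open>R\<close>, so
    \<open>P\<close> and \<open>Q\<close> are \<open>b\<close> and \<open>b'\<close> times the same
    integer function. Both take the value 1, hence \<open>b = b' = 1\<close> and
    \<open>P = Q\<close>.\<close>
  have same: "Q = P \<and> P z = - int 8 \<and> P (y\<^sup>2 + y) = - int (4 * m) \<and> P y = - int (2 * m) \<and> P x = - int (3 * m)"
    if Q: "place_at_infinity K x y z Q" for Q
  proof -
    have QQ: "place K Q"
      using Q by (simp add: place_at_infinity_def)
    obtain b where b: "b > 0" "P z = - b * int 8" "P (y\<^sup>2 + y) = - b * int (4 * m)"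
        "P y = - b * int (2 * m)" "P x = - b * int (3 * m)"
      using place_at_infinity_values[OF two c m(2) P] .
    obtain b' where b': "b' > 0" "Q z = - b' * int 8" "Q (y\<^sup>2 + y) = - b' * int (4 * m)"
        "Q y = - b' * int (2 * m)" "Q x = - b' * int (3 * m)"
      using place_at_infinity_values[OF two c m(2) Q] .
    have *: "\<exists>s. P f = b * s \<and> Q f = b' * s" for f
    proof (cases "f = 0")
      case True
      then show ?thesis
        using placeD(1)[OF PP] placeD(1)[OF QQ] by (intro exI[of _ 0]) simp
    next
      case False
      have "f \<in> fraction_field R"
        by (simp add: frac)
      then obtain g h where gh: "g \<in> R" "h \<in> R" "h \<noteq> 0" "f = g / h"
        by (auto simp: fraction_field_def)
      then have "g \<noteq> 0"
        using False by auto
      have "\<exists>s. P r = - b * int s \<and> Q r = - b' * int s" if "r \<in> R" "r \<noteq> 0" for r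
        using place_GGS2_ring[OF PP QQ _ m(2) b(1) b'(1) b(2-5) b'(2-5)] that is_subringD(1)[OF Kr]
        unfolding R_def by blast
      then obtain s s' where "P g = - b * int s" "Q g = - b' * int s" "P h = - b * int s'" "Q h = - b' * int s'"
        using gh \<open>g \<noteq> 0\<close> by metis
      then have "P f = b * (int s' - int s)" "Q f = b' * (int s' - int s)"
        using place_divide[OF PP \<open>g \<noteq> 0\<close> gh(3)] place_divide[OF QQ \<open>g \<noteq> 0\<close> gh(3)] gh(4)
        by (simp_all add: algebra_simps)
      then show ?thesis
        by blast
    qed
    have "b = 1" "b' = 1"
    proof -
      obtain f g where "P f = 1" "Q g = 1"
        using placeD(5)[OF PP] placeD(5)[OF QQ] by (metis surjD)
      then have "b dvd 1" "b' dvd 1"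
        using *[of f] *[of g] by (metis dvd_triv_left)+
      then show "b = 1" "b' = 1"
        using b(1) b'(1) by auto
    qed
    then have "Q f = P f" for f
      using *[of f] by auto
    then show ?thesis
      using b \<open>b = 1\<close> by auto
  qed
  note vals = same[OF P]
  \<comment> \<open>Taking norms down the three steps of the tower reaches
    \<open>K[z]\<close>.\<close>
  have dvd: "\<exists>g\<in>R. r * g \<in> poly_ring K z \<and> r * g \<noteq> 0" if r: "r \<in> R" "r \<noteq> 0" for r
  proof -
    have sub: "adjoin (poly_ring K z) (y\<^sup>2 + y) \<subseteq> R" "adjoin (adjoin (poly_ring K z) (y\<^sup>2 + y)) y \<subseteq> R"
      unfolding R_def GGS2_ring_def using subset_adjoin[OF tower(4)] subset_adjoin[OF tower(6)] by blast+
    obtain g1 where g1: "g1 \<in> R" "r * g1 \<in> adjoin (adjoin (poly_ring K z) (y\<^sup>2 + y)) y" "r * g1 \<noteq> 0"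
      using adjoin_dvd_base[OF two tower(6,7) r[unfolded R_def GGS2_ring_def]]
      unfolding R_def GGS2_ring_def by blast
    obtain g2 where g2: "g2 \<in> R" "r * g1 * g2 \<in> adjoin (poly_ring K z) (y\<^sup>2 + y)" "r * g1 * g2 \<noteq> 0"
      using adjoin_dvd_base[OF two tower(4,5) g1(2,3)] sub by blast
    obtain g3 where g3: "g3 \<in> R" "r * g1 * g2 * g3 \<in> poly_ring K z" "r * g1 * g2 * g3 \<noteq> 0"
      using adjoin_dvd_base[OF two tower(3,2) g2(2,3)] sub by blast
    have "g1 * g2 * g3 \<in> R"
      using g1(1) g2(1) g3(1) is_subringD(5)[OF R(1)] by blast
    then show ?thesis
      using g3(2,3) by (intro bexI[of _ "g1 * g2 * g3"]) (simp_all add: mult.assoc)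
  qed
  have frob: "\<exists>N'>0. \<forall>a\<in>R. a ^ (2 ^ N') - a \<in> I"
    if I: "is_ideal R I" and N: "N > 0" and A: "\<forall>a\<in>poly_ring K z. a ^ (2 ^ N) - a \<in> I" for I N
  proof -
    have sub: "adjoin (poly_ring K z) (y\<^sup>2 + y) \<subseteq> R" "adjoin (adjoin (poly_ring K z) (y\<^sup>2 + y)) y \<subseteq> R"
      unfolding R_def GGS2_ring_def using subset_adjoin[OF tower(4)] subset_adjoin[OF tower(6)] by blast+
    have "\<forall>a\<in>R. a ^ (2 ^ (N * 2 * 2 * 2)) - a \<in> I"
      unfolding R_def GGS2_ring_def
      using frobenius_fixed_adjoin[OF two R(1) I sub(2)
          frobenius_fixed_adjoin[OF two R(1) I sub(1)
            frobenius_fixed_adjoin[OF two R(1) I R(2) A _ tower(2)] _ tower(5)] _ tower(7)]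
        R(3) sub(1) tower(5) by blast
    then show ?thesis
      using N by (intro exI[of _ "N * 2 * 2 * 2"]) simp
  qed
  \<comment> \<open>The place with a pole of \<open>f\<close> is nonnegative on \<open>R\<close>, in
    particular at \<open>z\<close>, whereas \<open>P z\<close> is negative; so it is a place other
    than \<open>P\<close>.\<close>
  have regular: "f \<in> R" if "\<forall>Q. place K Q \<and> Q \<noteq> P \<longrightarrow> pole_order Q f = 0" for f
  proof (rule ccontr)
    assume "f \<notin> R"
    obtain Q where Q: "place K Q" "\<And>r. r \<in> R \<Longrightarrow> 0 \<le> Q r" "Q f < 0"
      by (rule exists_place_with_pole[OF two K _ z R(1,2) frac _ _ \<open>f \<notin> R\<close>])
        (use n in simp, erule (1) dvd, erule (2) frob, blast)
    then have "0 \<le> Q z"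
      using R(3) by blast
    then have "Q \<noteq> P"
      using vals by auto
    then show False
      using that Q(1,3) by (auto simp: pole_order_def)
  qed
  show ?thesis
  proof (intro subset_antisym subsetI)
    fix s assume "s \<in> weierstrass_semigroup K P"
    then obtain f where f: "f \<noteq> 0" "pole_order P f = s" "\<forall>Q. place K Q \<and> Q \<noteq> P \<longrightarrow> pole_order Q f = 0"
      by (auto simp: weierstrass_semigroup_def)
    obtain s' where "s' \<in> GGS2_semigroup m" "P f = - int s'"
      using place_GGS2_ring[OF PP PP is_subringD(1)[OF Kr] m(2), of 1 1 z y x f] vals regular[OF f(3)] f(1)
      by (auto simp: R_def)
    then show "s \<in> GGS2_semigroup m"
      using f(2) by (simp add: pole_order_def)
  next
    fix s assume "s \<in> GGS2_semigroup m"
    then obtain f where f: "f \<in> R" "f \<noteq> 0" "P f = - int s"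
      using GGS2_semigroup_attained[OF two Kr c \<open>m > 0\<close> PP] vals unfolding R_def by blast
    \<comment> \<open>By uniqueness \<open>Q\<close> is not at infinity, so its valuation ring
      contains \<open>K\<close>, \<open>x\<close>, \<open>y\<close>, \<open>z\<close> and therefore
      \<open>R\<close>.\<close>
    have "pole_order Q f = 0" if Q: "place K Q" "Q \<noteq> P" for Q
    proof -
      have "\<not> place_at_infinity K x y z Q"
        using same Q(2) by blast
      then have "R \<subseteq> {f. 0 \<le> Q f}"
        unfolding R_def using Q(1) placeD(4)[OF Q(1)]
        by (intro GGS2_ring_subset is_subring_valuation_ring) (auto simp: place_at_infinity_def)
      then show ?thesis
        using f(1) by (auto simp: pole_order_def)
    qed
    then show "s \<in> weierstrass_semigroup K P"
      using f by (auto simp: weierstrass_semigroup_def pole_order_def intro!: exI[of _ f])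
  qed
qed

section \<open>Counting decompositions\<close>

text \<open>\<open>apery_coeffs\<close> lists the values \<open>3 * i + 2 * j\<close>; times \<open>m\<close> they form the Apery set of the
  semigroup with respect to 8, since they are distinct modulo 8.\<close>

definition apery_coeffs :: "nat set" where
  "apery_coeffs = {0, 2, 3, 4, 5, 6, 7, 9}"

text \<open>The residue class of 1 is represented by 9.\<close>

definition partner :: "nat \<Rightarrow> nat \<Rightarrow> nat" where
  "partner c d = (let r = (c + 16 - d) mod 8 in if r = 1 then 9 else r)"

text \<open>A decomposition of \<open>c * m + 8 * k\<close> with first summand in class
  \<open>d\<close> uses up \<open>excess c d * m\<close> of the \<open>k\<close> available multiples
  of 8.\<close>

definition excess :: "nat \<Rightarrow> nat \<Rightarrow> nat" where
  "excess c d = (d + partner c d - c) div 8"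

definition pair_count :: "nat set \<Rightarrow> nat \<Rightarrow> nat" where
  "pair_count S s = card {(a, b). a \<in> S \<and> b \<in> S \<and> a + b = s}"

lemma GGS2_semigroup_eq: "GGS2_semigroup m = {c * m + 8 * k | c k. c \<in> apery_coeffs}"
proof -
  define cls where "cls c = {c * m + 8 * k | k. True}" for c
  have shift: "(\<lambda>s. s + a * m) ` cls c = cls (c + a)" for a c
    by (force simp: cls_def algebra_simps)
  have "range ((*) 8) = cls 0"
    by (auto simp: cls_def)
  then have "GGS2_semigroup m = (\<Union>c\<in>apery_coeffs. cls c)"
    by (simp add: GGS2_semigroup_def shift_union_def image_Un shift apery_coeffs_def Un_ac del: add_2_eq_Suc add_2_eq_Suc')
  then show ?thesis
    by (auto simp: cls_def)
qed

lemma partner_excess: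
  assumes "c \<in> apery_coeffs" "d \<in> apery_coeffs"
  shows "partner c d \<in> apery_coeffs" "d + partner c d = c + 8 * excess c d"
  using assms by (auto simp: apery_coeffs_def partner_def excess_def Let_def)

lemma apery_coeffs_mod_inj:
  assumes "c \<in> apery_coeffs" "d \<in> apery_coeffs" "8 dvd int c - int d"
  shows "c = d"
  using assms by (auto simp: apery_coeffs_def)

lemma odd_mult_cong8:
  assumes "odd m" "a * m + 8 * i = b * m + 8 * j"
  shows "8 dvd int a - int b"
proof -
  have "(int a - int b) * int m = int (a * m + 8 * i) - int (b * m + 8 * j) + 8 * (int j - int i)"
    by (simp add: algebra_simps)
  then have "8 dvd (int a - int b) * int m"
    unfolding assms(2) by simp
  moreover have "coprime (2 ^ 3 :: int) (int m)"
    using assms(1) by (intro coprime_power_left_iff[THEN iffD2]) auto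
  ultimately show ?thesis
    by (simp add: coprime_dvd_mult_left_iff)
qed

lemma GGS2_semigroup_rep_unique:
  assumes "odd m" "c \<in> apery_coeffs" "d \<in> apery_coeffs" "c * m + 8 * i = d * m + 8 * j"
  shows "c = d \<and> i = j"
  using apery_coeffs_mod_inj[OF assms(2,3) odd_mult_cong8[OF assms(1,4)]] assms(4) by simp

text \<open>The class \<open>d\<close> of the first summand forces the class of the second, since
  \<open>m\<close> is invertible modulo 8. It remains to split \<open>k - excess c d * m\<close>
  into two parts; truncated subtraction gives 0 when this is negative.\<close>

lemma pair_count_GGS2:
  assumes m: "odd m" and c: "c \<in> apery_coeffs"
  shows "pair_count (GGS2_semigroup m) (c * m + 8 * k) = (\<Sum>d\<in>apery_coeffs. k + 1 - excess c d * m)"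
proof -
  define f where "f = (\<lambda>(d, i). (d * m + 8 * i, partner c d * m + 8 * (k - excess c d * m - i)))"
  define A where "A = (SIGMA d:apery_coeffs. {..<k + 1 - excess c d * m})"
  define B where "B = {(a, b). a \<in> GGS2_semigroup m \<and> b \<in> GGS2_semigroup m \<and> a + b = c * m + 8 * k}"
  have SI: "d * m + 8 * i \<in> GGS2_semigroup m" if "d \<in> apery_coeffs" for d i
    using that unfolding GGS2_semigroup_eq by blast
  have "bij_betw f A B"
    unfolding bij_betw_def
  proof
    show "inj_on f A"
    proof (rule inj_onI)
      fix q q' assume q: "q \<in> A" "q' \<in> A" "f q = f q'"
      obtain d i where d: "q = (d, i)" "d \<in> apery_coeffs"
        using q(1) unfolding A_def by blast
      obtain d' i' where d': "q' = (d', i')" "d' \<in> apery_coeffs"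
        using q(2) unfolding A_def by blast
      have "d * m + 8 * i = d' * m + 8 * i'"
        using q(3) unfolding d(1) d'(1) f_def prod.case by (rule Pair_inject)
      then show "q = q'"
        using GGS2_semigroup_rep_unique[OF m d(2) d'(2)] unfolding d(1) d'(1) by blast
    qed
    show "f ` A = B"
    proof (intro subset_antisym subsetI)
      fix q assume "q \<in> f ` A"
      then obtain d i where d: "d \<in> apery_coeffs" "i < k + 1 - excess c d * m" "q = f (d, i)"
        by (auto simp: A_def)
      note p = partner_excess[OF c d(1)]
      have "d * m + partner c d * m = c * m + 8 * (excess c d * m)"
        using p(2) by (metis distrib_right mult.assoc)
      moreover have "i + (k - excess c d * m - i) + excess c d * m = k"
        using d(2) by simp
      ultimately have "d * m + 8 * i + (partner c d * m + 8 * (k - excess c d * m - i)) = c * m + 8 * k"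
        by linarith
      then show "q \<in> B"
        using SI[OF d(1)] SI[OF p(1)] unfolding d(3) B_def f_def mem_Collect_eq prod.case by blast
    next
      fix q assume "q \<in> B"
      then obtain d i e j where *: "d \<in> apery_coeffs" "e \<in> apery_coeffs" "q = (d * m + 8 * i, e * m + 8 * j)"
        "d * m + 8 * i + (e * m + 8 * j) = c * m + 8 * k"
        by (auto simp: B_def GGS2_semigroup_eq)
      note p = partner_excess[OF c *(1)]
      have "(d + e) * m + 8 * (i + j) = c * m + 8 * k"
        using *(4) by (simp add: algebra_simps)
      then have "8 dvd int (d + e) - int c"
        by (rule odd_mult_cong8[OF m])
      moreover have "int (d + e) - int c = int e - int (partner c d) + 8 * int (excess c d)"
        using p(2) by simp
      ultimately have "8 dvd int e - int (partner c d)"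
        by (metis dvd_add_times_triv_right_iff mult.commute)
      \<comment> \<open>Both are Apery coefficients in the same class modulo 8.\<close>
      then have e: "e = partner c d"
        by (rule apery_coeffs_mod_inj[OF *(2) p(1)])
      have "d * m + partner c d * m = c * m + 8 * (excess c d * m)"
        using p(2) by (metis distrib_right mult.assoc)
      then have k: "excess c d * m + i + j = k"
        using *(4) unfolding e by linarith
      then have "(d, i) \<in> A"
        using *(1) by (auto simp: A_def)
      moreover have "q = f (d, i)"
        using k by (auto simp: f_def *(3) e)
      ultimately show "q \<in> f ` A"
        by blast
    qed
  qed
  then have "card B = card A"
    using bij_betw_same_card by metis
  also have "card A = (\<Sum>d\<in>apery_coeffs. k + 1 - excess c d * m)"
    unfolding A_def by (subst card_SigmaI) (auto simp: apery_coeffs_def)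
  finally show ?thesis
    by (simp add: pair_count_def B_def)
qed

text \<open>For each \<open>c\<close> the coefficients of the three terms count the \<open>d\<close>
  with excess 0, 1 and 2.\<close>

lemma pair_count_GGS2_explicit:
  assumes m: "odd m"
  shows "pair_count (GGS2_semigroup m) (0 * m + 8 * k) = (k + 1) + 5 * (k + 1 - m) + 2 * (k + 1 - 2 * m)"
    "pair_count (GGS2_semigroup m) (2 * m + 8 * k) = 2 * (k + 1) + 5 * (k + 1 - m) + (k + 1 - 2 * m)"
    "pair_count (GGS2_semigroup m) (3 * m + 8 * k) = 2 * (k + 1) + 6 * (k + 1 - m)"
    "pair_count (GGS2_semigroup m) (4 * m + 8 * k) = 3 * (k + 1) + 5 * (k + 1 - m)"
    "pair_count (GGS2_semigroup m) (5 * m + 8 * k) = 4 * (k + 1) + 4 * (k + 1 - m)"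
    "pair_count (GGS2_semigroup m) (6 * m + 8 * k) = 5 * (k + 1) + 3 * (k + 1 - m)"
    "pair_count (GGS2_semigroup m) (7 * m + 8 * k) = 6 * (k + 1) + 2 * (k + 1 - m)"
    "pair_count (GGS2_semigroup m) (9 * m + 8 * k) = 8 * (k + 1)"
  by (subst pair_count_GGS2[OF m]; simp add: apery_coeffs_def excess_def partner_def)+

text \<open>The increasing enumeration of \<open>S\<close> turns the minimum over indices
  \<open>r \<ge> l\<close> into a minimum over semigroup elements from
  \<open>rho K P (l + 1)\<close> on.\<close>

lemma d_ORD_eqI:
  assumes S: "weierstrass_semigroup K P = S" "infinite S"
    and s0: "s0 \<in> S" "rho K P (l + 1) \<le> s0" "pair_count S s0 = d"
    and le: "\<And>s. s \<in> S \<Longrightarrow> rho K P (l + 1) \<le> s \<Longrightarrow> d \<le> pair_count S s"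
  shows "d_ORD K P l = d"
proof -
  \<comment> \<open>Since \<open>rho\<close> counts from 1 and \<open>enumerate\<close> from 0, the
    shift in \<open>nu\<close> cancels.\<close>
  have rho: "rho K P (r + 1) = enumerate S r" for r
    by (simp add: rho_def S)
  have nu: "nu K P r = pair_count S (enumerate S r)" for r
    by (simp add: nu_def S rho[unfolded Suc_eq_plus1[symmetric]] pair_count_def)
  obtain r0 where r0: "enumerate S r0 = s0"
    using enumerate_Ex[OF S(2)] s0(1) by blast
  have "l \<le> r0"
    using s0(2) r0 enumerate_mono[OF _ S(2), of r0 l] unfolding rho by (meson leD leI)
  then have "d \<in> {nu K P r | r. l \<le> r}"
    using r0 s0(3) nu by auto
  moreover have "d \<le> e" if "e \<in> {nu K P r | r. l \<le> r}" for e
  proof -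
    obtain r where r: "l \<le> r" "e = nu K P r"
      using \<open>e \<in> _\<close> by blast
    have "enumerate S l \<le> enumerate S r"
      using r(1) enumerate_mono[OF _ S(2), of l r] by (cases "l = r") auto
    then show ?thesis
      using le[of "enumerate S r"] enumerate_in_set[OF S(2)] by (simp only: r(2) nu rho)
  qed
  ultimately show ?thesis
    unfolding d_ORD_def by (rule cInf_eq_minimum)
qed

text \<open>Here \<open>a\<close> and \<open>b\<close> stand for the truncated differences \<open>j + 1 - m\<close> and \<open>j + 1 - 2 * m\<close>, and the
  lower bounds for \<open>j\<close> come from \<open>7 * m + 8 * k \<le> c * m + 8 * j\<close> with \<open>m = 8 * u + 3\<close>.\<close>

lemma pair_count_GGS2_ge:
  assumes m: "m = 8 * u + 3" and s: "s \<in> GGS2_semigroup m" "7 * m + 8 * k \<le> s"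
    and le: "\<And>j a b. 7 * u + k + 3 \<le> j \<Longrightarrow> j + 1 \<le> m + a \<Longrightarrow> j + 1 \<le> 2 * m + b \<Longrightarrow> d \<le> (j + 1) + 5 * a + 2 * b"
    "\<And>j a b. 5 * u + k + 2 \<le> j \<Longrightarrow> j + 1 \<le> m + a \<Longrightarrow> j + 1 \<le> 2 * m + b \<Longrightarrow> d \<le> 2 * (j + 1) + 5 * a + b"
    "\<And>j a. 4 * u + k + 2 \<le> j \<Longrightarrow> j + 1 \<le> m + a \<Longrightarrow> d \<le> 2 * (j + 1) + 6 * a"
    "\<And>j a. 3 * u + k + 2 \<le> j \<Longrightarrow> j + 1 \<le> m + a \<Longrightarrow> d \<le> 3 * (j + 1) + 5 * a"
    "\<And>j a. 2 * u + k + 1 \<le> j \<Longrightarrow> j + 1 \<le> m + a \<Longrightarrow> d \<le> 4 * (j + 1) + 4 * a"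
    "\<And>j a. u + k + 1 \<le> j \<Longrightarrow> j + 1 \<le> m + a \<Longrightarrow> d \<le> 5 * (j + 1) + 3 * a"
    "\<And>j a. k \<le> j \<Longrightarrow> j + 1 \<le> m + a \<Longrightarrow> d \<le> 6 * (j + 1) + 2 * a"
    "\<And>j. k \<le> j + 2 * u \<Longrightarrow> d \<le> 8 * (j + 1)"
  shows "d \<le> pair_count (GGS2_semigroup m) s"
proof -
  obtain c j where c: "c \<in> apery_coeffs" "s = c * m + 8 * j"
    using s(1) by (auto simp: GGS2_semigroup_eq)
  have "odd m"
    by (simp add: m)
  note count = pair_count_GGS2_explicit[OF this, of j]
  have a: "j + 1 \<le> m + (j + 1 - m)" and b: "j + 1 \<le> 2 * m + (j + 1 - 2 * m)"
    by simp_all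
  consider "c = 0" | "c = 2" | "c = 3" | "c = 4" | "c = 5" | "c = 6" | "c = 7" | "c = 9"
    using c(1) by (auto simp: apery_coeffs_def)
  then show ?thesis
  proof cases
    case 1
    have "7 * u + k + 3 \<le> j"
      using s(2) m unfolding c(2) 1 by presburger
    then show ?thesis
      unfolding c(2) 1 count by (rule le(1)[OF _ a b])
  next
    case 2
    have "5 * u + k + 2 \<le> j"
      using s(2) m unfolding c(2) 2 by presburger
    then show ?thesis
      unfolding c(2) 2 count by (rule le(2)[OF _ a b])
  next
    case 3
    have "4 * u + k + 2 \<le> j"
      using s(2) m unfolding c(2) 3 by presburger
    then show ?thesis
      unfolding c(2) 3 count by (rule le(3)[OF _ a])
  next
    case 4
    have "3 * u + k + 2 \<le> j"
      using s(2) m unfolding c(2) 4 by presburger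
    then show ?thesis
      unfolding c(2) 4 count by (rule le(4)[OF _ a])
  next
    case 5
    have "2 * u + k + 1 \<le> j"
      using s(2) m unfolding c(2) 5 by presburger
    then show ?thesis
      unfolding c(2) 5 count by (rule le(5)[OF _ a])
  next
    case 6
    have "u + k + 1 \<le> j"
      using s(2) m unfolding c(2) 6 by presburger
    then show ?thesis
      unfolding c(2) 6 count by (rule le(6)[OF _ a])
  next
    case 7
    have "k \<le> j"
      using s(2) unfolding c(2) 7 by simp
    then show ?thesis
      unfolding c(2) 7 count by (rule le(7)[OF _ a])
  next
    case 8
    have "k \<le> j + 2 * u"
      using s(2) m unfolding c(2) 8 by presburger
    then show ?thesis
      unfolding c(2) 8 count by (rule le(8))
  qed
qed

text \<open>With \<open>n = 2 * j + 5\<close> and \<open>4 ^ j = 3 * q + 1\<close> one gets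
  \<open>2 ^ n + 1 = 3 * (32 * q + 11)\<close>, so \<open>u = 4 * q + 1\<close>.\<close>

lemma GGS2_exponent:
  fixes m n :: nat
  assumes "5 \<le> n" "odd n" "m = (2 ^ n + 1) div 3"
  obtains u where "u \<ge> 1" "m = 8 * u + 3"
proof -
  obtain j where j: "n = 2 * j + 5"
  proof -
    have "n = 2 * ((n - 5) div 2) + 5"
      using assms(1,2) by presburger
    then show ?thesis
      using that by blast
  qed
  have "\<exists>q. (4::nat) ^ j = 3 * q + 1"
  proof (induction j)
    case (Suc j)
    then obtain q where "(4::nat) ^ j = 3 * q + 1"
      by blast
    then have "(4::nat) ^ Suc j = 3 * (4 * q + 1) + 1"
      by simp
    then show ?case
      by blast
  qed simp
  then obtain q where q: "(4::nat) ^ j = 3 * q + 1"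
    by blast
  have "(2::nat) ^ n = 32 * 4 ^ j"
    by (simp add: j power_add power_mult)
  then have "m = 8 * (4 * q + 1) + 3"
    using q assms(3) by simp
  then show ?thesis
    using that[of "4 * q + 1"] by simp
qed

theorem lemma3p7:
  fixes n m k l :: nat
    and K :: "'a::field set" and x y z :: 'a and P :: "'a \<Rightarrow> int"
  assumes "5 \<le> n" and "odd n" and "m = (2 ^ n + 1) div 3"
    and "GGS2_function_field n K x y z"
    and "place_at_infinity K x y z P"
    and "1 \<le> l" and "k < m" and "rho K P (l + 1) = 7 * m + 8 * k"
  shows
    "(k = 0 \<longrightarrow> d_ORD K P l = 6) \<and>
     (1 \<le> k \<and> int k \<le> \<lfloor>real m / 4\<rfloor> \<longrightarrow> d_ORD K P l = 8) \<and>
     (\<lceil>real m / 4\<rceil> \<le> int k \<and> int k \<le> \<lfloor>real m / 2\<rfloor> - 2 \<longrightarrow>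
        int (d_ORD K P l) = 8 * (\<lceil>real k - real m / 4\<rceil> + 1)) \<and>
     (\<lfloor>real m / 2\<rfloor> - 1 \<le> int k \<and> int k \<le> \<lfloor>3 * real m / 4\<rfloor> - 2 \<longrightarrow>
        int (d_ORD K P l) =
          2 * (\<lceil>real k + real m / 2\<rceil> + 1) + 6 * (\<lceil>real k + real m / 2\<rceil> - int m + 1)) \<and>
     (\<lfloor>3 * real m / 4\<rfloor> - 1 \<le> int k \<and> int k \<le> int m - 2 \<longrightarrow>
        int (d_ORD K P l) =
          4 * (\<lceil>real k + real m / 4\<rceil> + 1) + 4 * (\<lceil>real k + real m / 4\<rceil> - int m + 1)) \<and>
     (k = m - 1 \<longrightarrow> d_ORD K P l = nu K P l \<and> nu K P l = 6 * m)"
proof -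
  obtain u where u: "u \<ge> 1" "m = 8 * u + 3"
    using GGS2_exponent[OF assms(1-3)] .
  have m: "odd m"
    by (simp add: u(2))
  define S where "S = GGS2_semigroup m"
  have WS: "weierstrass_semigroup K P = S"
    unfolding S_def using assms(1) by (intro weierstrass_semigroup_GGS2[OF assms(4) _ assms(3) m assms(5)]) simp
  have "inj ((*) (8::nat))"
    by (simp add: inj_on_def)
  then have infS: "infinite S"
    unfolding S_def GGS2_semigroup_def shift_union_def by (simp add: range_inj_infinite)
  note count = pair_count_GGS2_explicit[OF m, folded S_def]
  have inS: "c * m + 8 * j \<in> S" if "c \<in> apery_coeffs" for c j
    using that unfolding S_def GGS2_semigroup_eq by blast
  note ge = pair_count_GGS2_ge[OF u(2), folded S_def]
  \<comment> \<open>In each range of \<open>k\<close> below, \<open>c\<close> and \<open>j\<close>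
    name the semigroup element at which the minimum is attained.\<close>
  have d: "d_ORD K P l = d" if "c \<in> apery_coeffs" "7 * m + 8 * k \<le> c * m + 8 * j" "pair_count S (c * m + 8 * j) = d"
    "\<And>s. s \<in> S \<Longrightarrow> 7 * m + 8 * k \<le> s \<Longrightarrow> d \<le> pair_count S s" for c j d
    by (rule d_ORD_eqI[OF WS infS inS[OF that(1)]]) (use that(2-4) assms(8) in auto)
  \<comment> \<open>As \<open>m = 8 * u + 3\<close>, all floors and ceilings become linear in
    \<open>u\<close> and \<open>k\<close>.\<close>
  have fl: "\<lfloor>real m / 4\<rfloor> = 2 * int u" "\<lfloor>real m / 2\<rfloor> = 4 * int u + 1" "\<lfloor>3 * real m / 4\<rfloor> = 6 * int u + 2"
    by (rule floor_unique; simp add: u(2))+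
  have ce: "\<lceil>real m / 4\<rceil> = 2 * int u + 1" "\<lceil>real k - real m / 4\<rceil> = int k - 2 * int u"
    "\<lceil>real k + real m / 2\<rceil> = int k + 4 * int u + 2" "\<lceil>real k + real m / 4\<rceil> = int k + 2 * int u + 1"
    by (rule ceiling_unique; simp add: u(2) field_simps)+
  have "d_ORD K P l = 6" if "k = 0"
  proof (rule d[of 7 0])
    show "6 \<le> pair_count S s" if "s \<in> S" "7 * m + 8 * k \<le> s" for s
      by (rule ge[OF that]; use u \<open>k = 0\<close> in simp)
  qed (use that count(7)[of 0] u in \<open>auto simp: apery_coeffs_def\<close>)
  \<comment> \<open>The minimum sits at \<open>9 * m\<close>, which is at least
    \<open>7 * m + 8 * k\<close> exactly while \<open>k \<le> 2 * u\<close>.\<close>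
  moreover have "d_ORD K P l = 8" if "1 \<le> k" "k \<le> 2 * u"
  proof (rule d[of 9 0])
    show "8 \<le> pair_count S s" if "s \<in> S" "7 * m + 8 * k \<le> s" for s
      by (rule ge[OF that]; use u \<open>1 \<le> k\<close> \<open>k \<le> 2 * u\<close> in simp)
  qed (use that count(8)[of 0] u in \<open>auto simp: apery_coeffs_def\<close>)
  moreover have "d_ORD K P l = 8 * (k - 2 * u + 1)" if "2 * u + 1 \<le> k" "k + 1 \<le> 4 * u"
  proof -
    obtain i where i: "k = 2 * u + 1 + i"
      using \<open>2 * u + 1 \<le> k\<close> le_Suc_ex by blast
    have "d_ORD K P l = 8 * (i + 2)"
    \<comment> \<open>The first element of class 9 from \<open>7 * m + 8 * k\<close> on has
      \<open>j = k - 2 * u = i + 1\<close>.\<close>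
    proof (rule d[of 9 "i + 1"])
      show "8 * (i + 2) \<le> pair_count S s" if "s \<in> S" "7 * m + 8 * k \<le> s" for s
        by (rule ge[OF that]; use u \<open>k + 1 \<le> 4 * u\<close> i in simp)
    qed (use that count(8)[of "i + 1"] u i in \<open>auto simp: apery_coeffs_def\<close>)
    then show ?thesis
      by (simp add: i)
  qed
  moreover have "d_ORD K P l = 2 * (k + 4 * u + 3) + 6 * (k - 4 * u)" if "4 * u \<le> k" "k \<le> 6 * u"
  proof -
    obtain i where i: "k = 4 * u + i"
      using \<open>4 * u \<le> k\<close> le_Suc_ex by blast
    have "d_ORD K P l = 2 * (8 * u + i + 3) + 6 * i"
    \<comment> \<open>In class 3 the first admissible index is \<open>k + 4 * u + 2\<close>, that is
      \<open>k + m / 2\<close> rounded up.\<close>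
    proof (rule d[of 3 "8 * u + i + 2"])
      show "2 * (8 * u + i + 3) + 6 * i \<le> pair_count S s" if "s \<in> S" "7 * m + 8 * k \<le> s" for s
        by (rule ge[OF that]; use u \<open>k \<le> 6 * u\<close> i in simp)
    qed (use that count(3)[of "8 * u + i + 2"] u i in \<open>auto simp: apery_coeffs_def\<close>)
    then show ?thesis
      by (simp add: i)
  qed
  moreover have "d_ORD K P l = 4 * (k + 2 * u + 2) + 4 * (k - 6 * u - 1)" if "6 * u + 1 \<le> k" "k \<le> 8 * u + 1"
  proof -
    obtain i where i: "k = 6 * u + 1 + i"
      using \<open>6 * u + 1 \<le> k\<close> le_Suc_ex by blast
    have "d_ORD K P l = 4 * (8 * u + i + 3) + 4 * i"
    \<comment> \<open>In class 5 the first admissible index is \<open>k + 2 * u + 1\<close>, that is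
      \<open>k + m / 4\<close> rounded up.\<close>
    proof (rule d[of 5 "8 * u + i + 2"])
      show "4 * (8 * u + i + 3) + 4 * i \<le> pair_count S s" if "s \<in> S" "7 * m + 8 * k \<le> s" for s
        by (rule ge[OF that]; use u \<open>k \<le> 8 * u + 1\<close> i in simp)
    qed (use that count(5)[of "8 * u + i + 2"] u i in \<open>auto simp: apery_coeffs_def\<close>)
    then show ?thesis
      by (simp add: i)
  qed
  moreover have "d_ORD K P l = 6 * m" if "k = 8 * u + 2"
  \<comment> \<open>For \<open>k = m - 1\<close> the minimum is attained at
    \<open>rho K P (l + 1)\<close> itself, so it equals \<open>nu K P l\<close>.\<close>
  proof (rule d[of 7 k])
    show "6 * m \<le> pair_count S s" if "s \<in> S" "7 * m + 8 * k \<le> s" for s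
      by (rule ge[OF that]; use u \<open>k = 8 * u + 2\<close> in simp)
  qed (use that count(7)[of k] u in \<open>auto simp: apery_coeffs_def\<close>)
  moreover have "nu K P l = 6 * m" if "k = 8 * u + 2"
  proof -
    have "nu K P l = pair_count S (7 * m + 8 * k)"
      using assms(8) by (simp add: nu_def WS pair_count_def)
    then show ?thesis
      using count(7)[of k] that u by simp
  qed
  ultimately show ?thesis
    unfolding fl ce using u(2) by (intro conjI impI) auto
qed

end
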